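(* Assume $\rho\in(0,1)$. (i) For $\alpha>0$ and $|\arg(z)|<\pi$: $\ \phi\left(\frac1z;\alpha,\rho\right)=z^{\alpha\rho}\phi(z;\alpha,\rho)$. (ii) For $\alpha\in(0,\rho^{-1})$ and $|\arg(z)|<\pi\min\{1,\frac1\alpha\}$: $\ \phi(z;\alpha,\rho)=\phi\left(z^\alpha;\frac1\alpha,\alpha\rho\right)$. (iii) For integers $n\ge2$, $\alpha>n-1$ and $|\arg(z)|<\pi\left(1-\frac{n-1}{\alpha}\right)$: $\ \phi(z;\alpha,\rho)=\prod_{k=0}^{n-1}\phi\left(ze^{(n-2k-1)\pi i/\alpha};\frac\alpha n,\rho\right)$. (iv) For $\alpha>0$ and $\mathrm{Im}(z)\ne0$: $\ \phi(z;\alpha,1-\rho)\,\phi(-z;\alpha,\rho)=\left(1+e^{-\delta\pi i\alpha\rho}z^\alpha\right)^{-1}$, where $\delta=\mathrm{sign}(\mathrm{Im}(z))$.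
   Context: All identities are between meromorphic functions; powers are principal, $z^a=e^{a\ln z}$ for $|\arg z|<\pi$. Definition of $\phi$. The admissible set is $\mathcal A=\{\alpha\in(0,1),\rho\in(0,1)\}\cup\{\alpha=1,\rho=\frac12\}\cup\{\alpha\in(1,2),\rho\in[1-\alpha^{-1},\alpha^{-1}]\}$. For $(\alpha,\rho)\in\mathcal A$, let $X_t$ be the stable Lévy process with $X_0=0$, $\mathbb E[e^{izX_t}]=e^{-t\Psi(z)}$, $z\in\mathbb R$, $\Psi(z)=e^{\pi i\gamma/2}|z|^\alpha$ for $z>0$, $\Psi(z)=e^{-\pi i\gamma/2}|z|^\alpha$ for $z<0$, $\gamma=\alpha(1-2\rho)$; then $\phi(z;\alpha,\rho)=\mathbb E[e^{-zS_{e(1)}}]$ for $\mathrm{Re}(z)\ge0$, where $S_t=\sup_{0\le u\le t}X_u$ and $e(1)$ is an independent unit-mean exponential variable. For general $\alpha>0$, $\rho\in(0,1)$ the function is extended by analytic continuation in the parameters: for $z>0$, $$\phi(z;\alpha,\rho)=\exp\left(\int_0^z\frac{1}{2\pi iu}\left[F(\pi i\rho-\ln u;i/\alpha)-F(-\pi i\rho-\ln u;i/\alpha)\right]du\right),\quad F(w;i/\alpha)=\int_{\mathbb R}\frac{dx}{(1+e^{w-x/\alpha})(1+e^x)}\ (|\mathrm{Im}\,w|<\pi),$$ which agrees with the probabilistic definition when $(\alpha,\rho)\in\mathcal A$; for complex $z$ with $|\arg z|<\pi$, $\phi$ denotes the meromorphic continuation in $z$. *)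

theory Defs
  imports "HOL-Complex_Analysis.Complex_Analysis"
begin

definition sector :: "real \<Rightarrow> complex set" where
  "sector \<theta> = {z. z \<noteq> 0 \<and> \<bar>Arg z\<bar> < \<theta>}"

text \<open>
  Equality of meromorphic functions on an open set. HOL functions are total, so an expression
  such as a product takes some junk value at a point where one of its factors has a pole; an
  identity of meromorphic functions is therefore equality away from a set of isolated points of \<open>S\<close>
  (by continuity, the two sides then have the same poles in \<open>S\<close> and the same value wherever
  both of them are continuous).
\<close>

definition mero_eq :: "complex set \<Rightarrow> (complex \<Rightarrow> complex) \<Rightarrow> (complex \<Rightarrow> complex) \<Rightarrow> bool" where
  "mero_eq S f g \<longleftrightarrow>
     f meromorphic_on S \<and> g meromorphic_on S \<and> (\<forall>\<^sub>\<approx>z\<in>S. f z = g z)"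

text \<open>
  \<open>F_int \<alpha> w\<close> is $F(w; i/\alpha)$. The integral converges absolutely for $|\mathrm{Im}\, w| < \pi$.
\<close>

definition F_int :: "real \<Rightarrow> complex \<Rightarrow> complex" where
  "F_int \<alpha> w =
     (LINT x|lborel. 1 / ((1 + exp (w - of_real (x / \<alpha>))) * (1 + of_real (exp x))))"

text \<open>
  For $(\alpha,\rho)$ admissible for a stable process $X$, \<open>phi_pos \<alpha> \<rho> z\<close> is the Laplace transform
  $E[e^{-zS}]$ of the supremum $S$ of $X$ up to an independent unit-mean exponential time. The
  formula below is the one that makes sense for all $\alpha > 0$ and $0 < \rho < 1$.
\<close>

definition phi_pos :: "real \<Rightarrow> real \<Rightarrow> real \<Rightarrow> complex" where
  "phi_pos \<alpha> \<rho> z =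
     exp (LINT u:{0<..<z}|lborel.
            1 / (2 * of_real pi * \<i> * of_real u) *
            (F_int \<alpha> (of_real pi * \<i> * of_real \<rho> - of_real (ln u))
             - F_int \<alpha> (- of_real pi * \<i> * of_real \<rho> - of_real (ln u))))"

text \<open>
  The meromorphic continuation of \<^const>\<open>phi_pos\<close> from the positive half-line to the plane cut
  along the nonpositive reals. It is pinned down uniquely by the identity theorem, once the
  removable singularities are filled in and the value $0$ is fixed at the poles (this is what
  \<open>nicely_meromorphic_on\<close> does) and on the cut.
\<close>

definition phi :: "complex \<Rightarrow> real \<Rightarrow> real \<Rightarrow> complex" where
  "phi z \<alpha> \<rho> =
     (THE f. f nicely_meromorphic_on sector pi \<and>
             (\<forall>x>0. f (of_real x) = phi_pos \<alpha> \<rho> x) \<and>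
             (\<forall>w. w \<notin> sector pi \<longrightarrow> f w = 0)) z"

end

theory Submission
  imports Defs "HOL-Probability.Sinc_Integral" "HOL-Real_Asymp.Real_Asymp"
begin

text \<open>
  On the half-line put \<open>z = exp t\<close>. Then \<open>\<phi>(z; \<alpha>, \<rho>) = exp (H t)\<close> with
  \[ 2 \pi i\, H'(t) = F(\pi i \rho - t) - F(-\pi i \rho - t), \qquad H(-\infty) = 0, \]
  so every identity for \<open>\<phi>\<close> is the integrated form of an identity for \<open>F\<close>, the constant of
  integration being fixed at \<open>t = -\<infinity>\<close> (or at \<open>t = 0\<close> for the inversion). The four identities
  for \<open>F = F(\<cdot>; i/\<alpha>)\<close> behind the four claims are

  \<^item> reflection, \<open>F(-w) = F(w) + \<alpha> w\<close>;
  \<^item> duality, \<open>F(w; i/\<alpha>) = \<alpha> F(\<alpha> w; i \<alpha>)\<close>;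
  \<^item> multiplication, which writes \<open>F(w; i/\<alpha>)\<close> as the sum of the \<open>n\<close> values
    \<open>F(w + (n - 2 k - 1) \<pi> i / \<alpha>; i n/\<alpha>)\<close> and rests on the partial fractions of \<open>n / (1 + y^n)\<close>;
  \<^item> the jump \<open>F(w + \<pi> i) - F(w - \<pi> i) = - 2 \<pi> i \<alpha> / (1 + e^(\<alpha> w))\<close>.

  The last two involve values of \<open>F\<close> outside the strip \<open>|Im w| < \<pi>\<close> in which
  its integral converges. The integrand is a product of two Fermi factors \<open>1 / (1 + e^v)\<close>, and a
  translation of the integration variable distributes \<open>w\<close> between them as \<open>p w\<close> and \<open>q w\<close> with
  \<open>p + q/\<alpha> = 1\<close>. For real \<open>w\<close> this changes nothing, whereas for complex \<open>w\<close> the integral now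
  converges when \<open>p |Im w|\<close> and \<open>q |Im w|\<close> are both less than \<open>\<pi>\<close>. The balanced choice
  \<open>p = q = \<alpha> / (\<alpha> + 1)\<close> therefore continues \<open>F\<close> to \<open>|Im w| < \<pi> + \<pi>/\<alpha>\<close> (\<open>F_ext\<close>). Duality
  is a substitution in the balanced integral; the other identities for \<open>F\<close> are checked on the real
  axis and carried over by the identity theorem.

  Consequently \<open>H\<close> (\<open>log_phi\<close>) is holomorphic in \<open>|Im t| < \<pi> (1 - \<rho>) + \<pi>/\<alpha>\<close>, and \<open>\<phi>\<close> has neither
  zeros nor poles in the corresponding sector. When \<open>\<alpha> \<rho> > 1\<close> that sector is smaller than the cut
  plane. The jump identity then says that, on an overlap of two strips,
  \<open>exp (H_(1-\<rho>)(t + \<pi> i)) exp (H_\<rho> t)\<close> is the reciprocal of an explicit entire function. Solving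
  for \<open>exp (H_\<rho> t)\<close> continues \<open>\<phi>\<close> meromorphically to the whole cut plane (\<open>phi_cont_meromorphic\<close>),
  so that a function as described in the definition of \<open>phi\<close> exists; the identity theorem makes it
  unique (\<open>phi_eq_remove_sings\<close>). From there on each claim compares two meromorphic functions on a
  connected open set (for the last claim, on each half-plane separately), so that it suffices to
  compare them on a single ray, where the values of \<open>\<phi>\<close> that occur are exponentials of values of \<open>H\<close>.
\<close>

section \<open>Holomorphic functions on strips\<close>

text \<open>
  Difference quotients of the integrand are bounded through Cauchy's estimate by a multiple of the
  same dominating function, so dominated convergence applies to them.
\<close>
lemma holomorphic_on_parametric_integral:
  fixes f :: "complex \<Rightarrow> 'a \<Rightarrow> complex"
  assumes "open S"
    and holo: "\<And>x. (\<lambda>w. f w x) holomorphic_on S"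
    and meas: "\<And>w. w \<in> S \<Longrightarrow> f w \<in> borel_measurable M"
    and dom: "\<And>w0. w0 \<in> S \<Longrightarrow>
      \<exists>r>0. \<exists>g. integrable M g \<and> (\<forall>w\<in>ball w0 r \<inter> S. \<forall>x. norm (f w x) \<le> g x)"
  shows "(\<lambda>w. LINT x|M. f w x) holomorphic_on S"
proof -
  have "(\<lambda>w. LINT x|M. f w x) field_differentiable (at w0)" if w0: "w0 \<in> S" for w0
  proof -
    obtain r g where r: "r > 0" and g: "integrable M g"
      and bd: "\<And>w x. w \<in> ball w0 r \<inter> S \<Longrightarrow> norm (f w x) \<le> g x"
      using dom[OF w0] by blast
    obtain e where e: "e > 0" "ball w0 e \<subseteq> S"
      using \<open>open S\<close> w0 openE by blast
    \<comment> \<open>The factor 1/2 leaves room for discs of radius \<open>d\<close> about every point of \<open>ball w0 d\<close>.\<close>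
    define d where "d = min r e / 2"
    have d: "d > 0" using r e by (simp add: d_def)
    have sub: "ball w0 (2 * d) \<subseteq> ball w0 r \<inter> S"
      using e by (auto simp: d_def)
    have sub': "cball w d \<subseteq> ball w0 (2 * d)" if "w \<in> ball w0 d" for w
    proof
      fix y assume "y \<in> cball w d"
      then show "y \<in> ball w0 (2 * d)"
        using that dist_triangle[of w0 y w] by auto
    qed
    have intg: "integrable M (f w)" if "w \<in> ball w0 (2 * d)" for w
      by (rule Bochner_Integration.integrable_bound[OF g meas]) (use sub bd that in \<open>auto intro!: AE_I2 order_trans[OF bd]\<close>)
    \<comment> \<open>Cauchy's estimate turns the bound on the integrand into one on its derivative.\<close>
    have dbd: "norm (deriv (\<lambda>w. f w x) w) \<le> g x / d" if w: "w \<in> ball w0 d" for w x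
    proof -
      have "norm ((deriv ^^ 1) (\<lambda>w. f w x) w) \<le> fact 1 * g x / d ^ 1"
      proof (rule Cauchy_inequality)
        have *: "cball w d \<subseteq> S" using sub' [OF w] sub by blast
        show "(\<lambda>w. f w x) holomorphic_on ball w d"
          using * by (intro holomorphic_on_subset[OF holo]) auto
        show "continuous_on (cball w d) (\<lambda>w. f w x)"
          using * by (intro holomorphic_on_imp_continuous_on holomorphic_on_subset[OF holo]) auto
        show "norm (f y x) \<le> g x" if "norm (w - y) = d" for y
        proof (rule bd)
          show "y \<in> ball w0 r \<inter> S"
            using sub'[OF w] sub that by (auto simp: dist_norm subset_iff)
        qed
      qed (fact d)
      then show ?thesis by simp
    qed
    have hd: "((\<lambda>w. f w x) has_field_derivative deriv (\<lambda>w. f w x) w) (at w)" if "w \<in> ball w0 d" for w x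
      by (rule holomorphic_derivI[OF holo \<open>open S\<close>]) (use sub sub'[OF that] d in \<open>auto simp: subset_iff\<close>)
    have quot: "norm ((f w x - f w0 x) / (w - w0)) \<le> g x / d" if w: "w \<in> ball w0 d" "w \<noteq> w0" for w x
    proof -
      have "norm (f w x - f w0 x) \<le> g x / d * norm (w - w0)"
        by (rule field_differentiable_bound[of "ball w0 d" "\<lambda>w. f w x" "\<lambda>w. deriv (\<lambda>w. f w x) w"])
           (use w d dbd in \<open>auto intro!: has_field_derivative_at_within[OF hd]\<close>)
      then show ?thesis using w by (simp add: norm_divide divide_le_eq mult.commute)
    qed
    have "((\<lambda>w. LINT x|M. f w x) has_field_derivative (LINT x|M. deriv (\<lambda>w. f w x) w0)) (at w0)"
      unfolding has_field_derivative_iff tendsto_at_iff_sequentially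
    proof (intro allI impI)
      fix X :: "nat \<Rightarrow> complex"
      assume X: "\<forall>i. X i \<in> UNIV - {w0}" "X \<longlonglongrightarrow> w0"
      have "\<forall>\<^sub>F n in sequentially. X n \<in> ball w0 d"
        using tendstoD[OF X(2) d] by (auto simp: dist_commute)
      then obtain N where N: "\<And>n. n \<ge> N \<Longrightarrow> X n \<in> ball w0 d"
        by (auto simp: eventually_sequentially)
      \<comment> \<open>The dominated convergence theorem wants its bound for every index, hence the shift.\<close>
      define Y where "Y n = X (n + N)" for n
      have Y: "Y n \<in> ball w0 d" "Y n \<noteq> w0" for n
        using N X(1) by (auto simp: Y_def)
      have Ylim: "Y \<longlonglongrightarrow> w0" unfolding Y_def using X(2) by (rule LIMSEQ_ignore_initial_segment)
      have Y2: "Y n \<in> ball w0 (2 * d)" for n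
        using Y(1)[of n] d by auto
      have w02: "w0 \<in> ball w0 (2 * d)" using d by simp
      have ptw: "(\<lambda>n. (f (Y n) x - f w0 x) / (Y n - w0)) \<longlonglongrightarrow> deriv (\<lambda>w. f w x) w0" for x
        using hd[of w0 x] d Ylim Y(2)
        unfolding has_field_derivative_iff tendsto_at_iff_sequentially by (auto simp: o_def)
      have measq: "(\<lambda>x. (f (Y n) x - f w0 x) / (Y n - w0)) \<in> borel_measurable M" for n
        using intg[OF Y2[of n], THEN borel_measurable_integrable] intg[OF w02, THEN borel_measurable_integrable] by measurable
      have "(\<lambda>n. LINT x|M. (f (Y n) x - f w0 x) / (Y n - w0)) \<longlonglongrightarrow> (LINT x|M. deriv (\<lambda>w. f w x) w0)"
      proof (rule integral_dominated_convergence)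
        show "(\<lambda>x. deriv (\<lambda>w. f w x) w0) \<in> borel_measurable M"
          by (rule borel_measurable_LIMSEQ_metric[OF measq ptw])
        show "integrable M (\<lambda>x. g x / d)" using g by simp
        show "AE x in M. norm ((f (Y i) x - f w0 x) / (Y i - w0)) \<le> g x / d" for i
          using quot[OF Y] by simp
      qed (use measq ptw in auto)
      also have "(\<lambda>n. LINT x|M. (f (Y n) x - f w0 x) / (Y n - w0)) =
          (\<lambda>n. ((LINT x|M. f (Y n) x) - (LINT x|M. f w0 x)) / (Y n - w0))"
        using intg[OF Y2] intg[OF w02] by (simp add: Bochner_Integration.integral_diff)
      finally have "(\<lambda>n. ((LINT x|M. f (X (n+N)) x) - (LINT x|M. f w0 x)) / (X (n+N) - w0))
           \<longlonglongrightarrow> (LINT x|M. deriv (\<lambda>w. f w x) w0)" by (simp add: Y_def)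
      then show "((\<lambda>y. ((LINT x|M. f y x) - (LINT x|M. f w0 x)) / (y - w0)) \<circ> X)
           \<longlonglongrightarrow> (LINT x|M. deriv (\<lambda>w. f w x) w0)"
        unfolding o_def by (rule LIMSEQ_offset)
    qed
    then show ?thesis by (auto simp: field_differentiable_def)
  qed
  then show ?thesis
    unfolding holomorphic_on_def using field_differentiable_at_within by blast
qed

definition strip :: "real \<Rightarrow> complex set" where
  "strip B = {w. \<bar>Im w\<bar> < B}"

lemma open_strip: "open (strip B)"
  unfolding strip_def by (intro open_Collect_less continuous_intros)

lemma convex_strip: "convex (strip B)"
proof -
  have "strip B = {w. Im w < B} \<inter> {w. Im w > -B}" by (auto simp: strip_def)
  then show ?thesis by (simp add: convex_Int convex_halfspace_Im_lt convex_halfspace_Im_gt)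
qed

lemma strip_identity:
  assumes "f holomorphic_on strip B" "g holomorphic_on strip B"
    and eq: "\<And>s::real. f (of_real s) = g (of_real s)" and w: "w \<in> strip B"
  shows "f w = g w"
proof -
  have B: "B > 0" using w by (auto simp: strip_def)
  have "f w - g w = 0"
  proof (rule analytic_continuation[of "\<lambda>w. f w - g w" "strip B" "range of_real" 0])
    show "(\<lambda>w. f w - g w) holomorphic_on strip B"
      using assms by (intro holomorphic_intros)
    show "connected (strip B)" by (simp add: convex_connected convex_strip)
    show "range of_real \<subseteq> strip B" using B by (auto simp: strip_def)
    show "0 \<in> strip B" using B by (auto simp: strip_def)
    have "(\<lambda>n. complex_of_real (1 / real (Suc n))) \<longlonglongrightarrow> of_real 0"
      by (intro tendsto_of_real LIMSEQ_Suc lim_1_over_n)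
    then have "(\<lambda>n. complex_of_real (1 / real (Suc n))) \<longlonglongrightarrow> 0" by simp
    moreover have "complex_of_real (1 / real (Suc n)) \<in> range of_real - {0}" for n
      by (metis Diff_iff divide_eq_0_iff nat.distinct(1) of_nat_eq_0_iff of_real_eq_0_iff rangeI singletonD zero_neq_one)
    ultimately show "0 islimpt range complex_of_real"
      unfolding islimpt_sequential by (intro exI[of _ "\<lambda>n. complex_of_real (1 / real (Suc n))"]) blast
  qed (use eq w open_strip in auto)
  then show ?thesis by simp
qed

section \<open>Fermi factors\<close>

definition fermi :: "complex \<Rightarrow> complex" where
  "fermi v = 1 / (1 + exp v)"

lemma one_plus_exp_neq_0: "\<bar>Im v\<bar> < pi \<Longrightarrow> 1 + exp v \<noteq> (0::complex)"
proof
  assume v: "\<bar>Im v\<bar> < pi" and "1 + exp v = 0"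
  then have "exp v = -1" by (simp add: add_eq_0_iff)
  then have "Ln (-1) = v" using v by (metis Ln_exp abs_less_iff less_imp_le minus_less_iff)
  then show False using v by auto
qed

text \<open>
  Since \<open>cos y = 1 - 2 (sin (y/2))^2\<close>, the square of the left-hand norm is
  \<open>(1 + e^x)^2 - 4 e^x (sin (y/2))^2\<close>, and \<open>4 e^x \<le> (1 + e^x)^2\<close>. So for \<open>|Im v| \<le> \<theta> < \<pi>\<close> a Fermi
  factor is at most \<open>1 / cos (\<theta>/2)\<close> times its value at the real part.
\<close>
lemma norm_one_plus_exp_ge:
  assumes "\<bar>Im v\<bar> \<le> \<theta>" "\<theta> \<le> pi"
  shows "norm (1 + exp v) \<ge> cos (\<theta> / 2) * (1 + exp (Re v))"
proof -
  define a where "a = exp (Re v)"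
  define b where "b = \<bar>Im v\<bar> / 2"
  have a: "a > 0" by (simp add: a_def)
  have cb: "cos (Im v) = 2 * (cos b)\<^sup>2 - 1"
  proof -
    have "cos (Im v) = cos (2 * b)" by (simp add: b_def)
    then show ?thesis by (simp add: cos_double_cos)
  qed
  have mono: "cos (\<theta>/2) \<le> cos b"
    using assms by (intro cos_monotone_0_pi_le) (auto simp: b_def)
  have nn: "cos (\<theta>/2) \<ge> 0" using assms by (intro cos_ge_zero) auto
  have e: "1 + exp v = Complex (1 + a * cos (Im v)) (a * sin (Im v))"
    by (simp add: complex_eq_iff a_def Re_exp Im_exp)
  have "(norm (1 + exp v))\<^sup>2 = (1 + a * cos (Im v))\<^sup>2 + (a * sin (Im v))\<^sup>2"
    unfolding e cmod_power2 by simp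
  also have "\<dots> = 1 + 2 * a * cos (Im v) + a\<^sup>2 * ((cos (Im v))\<^sup>2 + (sin (Im v))\<^sup>2)"
    by (simp only: power2_eq_square ring_distribs) algebra
  also have "\<dots> = 1 + 2 * a * (2 * (cos b)\<^sup>2 - 1) + a\<^sup>2"
    unfolding cb[symmetric] by simp
  also have "\<dots> \<ge> (cos b * (1 + a))\<^sup>2"
  proof -
    have "1 + 2 * a * (2 * (cos b)\<^sup>2 - 1) + a\<^sup>2 - (cos b * (1 + a))\<^sup>2 = (1 - (cos b)\<^sup>2) * (1 - a)\<^sup>2"
      by (simp add: power2_eq_square algebra_simps)
    moreover have "(1 - (cos b)\<^sup>2) * (1 - a)\<^sup>2 \<ge> 0"
      by (intro mult_nonneg_nonneg) (auto simp: abs_square_le_1)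
    ultimately show ?thesis by linarith
  qed
  finally have "cos b * (1 + a) \<le> norm (1 + exp v)"
    by (rule power2_le_imp_le) auto
  moreover have "cos (\<theta>/2) * (1 + a) \<le> cos b * (1 + a)"
    using mono a by (intro mult_right_mono) auto
  ultimately show ?thesis by (simp add: a_def)
qed

lemma norm_fermi_le:
  assumes "\<bar>Im v\<bar> \<le> \<theta>" "\<theta> < pi"
  shows "norm (fermi v) \<le> min 1 (exp (- Re v)) / cos (\<theta> / 2)"
proof -
  have "\<theta> \<ge> 0" using assms by linarith
  then have c: "cos (\<theta> / 2) > 0" using assms by (intro cos_gt_zero_pi) auto
  have pos: "norm (1 + exp v) \<ge> cos (\<theta> / 2) * (1 + exp (Re v))" "cos (\<theta> / 2) * (1 + exp (Re v)) > 0"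
    using norm_one_plus_exp_ge[of v \<theta>] assms c by (auto intro!: mult_pos_pos add_pos_pos)
  have "norm (fermi v) = 1 / norm (1 + exp v)" by (simp add: fermi_def norm_divide)
  also have "\<dots> \<le> 1 / (cos (\<theta> / 2) * (1 + exp (Re v)))"
    using pos by (intro divide_left_mono) (auto intro: mult_pos_pos less_le_trans)
  also have "\<dots> = 1 / (1 + exp (Re v)) / cos (\<theta> / 2)" by simp
  also have "\<dots> \<le> min 1 (exp (- Re v)) / cos (\<theta> / 2)"
    using c by (intro divide_right_mono) (auto simp: exp_minus field_simps add_pos_pos)
  finally show ?thesis .
qed

lemma holomorphic_on_fermi [holomorphic_intros]:
  assumes "f holomorphic_on A" "\<And>z. z \<in> A \<Longrightarrow> \<bar>Im (f z)\<bar> < pi"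
  shows "(\<lambda>z. fermi (f z)) holomorphic_on A"
  unfolding fermi_def using assms by (intro holomorphic_intros one_plus_exp_neq_0)

lemma fermi_measurable [measurable]: "fermi \<in> borel_measurable borel"
proof -
  have "(\<lambda>v::complex. 1 + exp v) \<in> borel_measurable borel"
    by (intro borel_measurable_continuous_onI continuous_intros)
  then show ?thesis unfolding fermi_def by measurable
qed

section \<open>The integral and its continuation\<close>

text \<open>
  The integral of two Fermi factors with the argument \<open>w\<close> distributed between them in the
  proportions \<open>p\<close> and \<open>q\<close>. The integral of the definition of \<open>\<phi>\<close> is the case \<open>(p, q) = (1, 0)\<close>; the case
  \<open>(p, q) = (0, \<alpha>)\<close> converges for \<open>|Im w| < \<pi>/\<alpha>\<close> instead of \<open>|Im w| < \<pi>\<close>.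
\<close>
definition fd_int :: "real \<Rightarrow> real \<Rightarrow> real \<Rightarrow> complex \<Rightarrow> complex" where
  "fd_int \<alpha> p q w =
     (LINT x|lborel. fermi (of_real p * w - of_real (x / \<alpha>)) * fermi (of_real q * w + of_real x))"

lemma integrable_exp_minus_abs:
  fixes m :: real
  assumes "m > 0"
  shows "integrable lborel (\<lambda>x::real. exp (- m * \<bar>x\<bar>))"
proof (rule Bochner_Integration.integrable_bound)
  define A where "A = (\<lambda>x::real. indicator {0..} x *\<^sub>R exp (- m * x))"
  have "(\<lambda>x. exp (- m * x)) absolutely_integrable_on {0..}"
    using assms by (intro nonnegative_absolutely_integrable_1 integrable_on_exp_minus_to_infinity) auto
  then have "integrable lebesgue A" unfolding set_integrable_def A_def .
  then have A: "integrable lborel A"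
    by (subst (asm) integrable_completion) (auto simp: A_def)
  then have "integrable lborel (\<lambda>x. A (0 + (-1) * x))"
    by (intro lborel_integrable_real_affine) auto
  with A show "integrable lborel (\<lambda>x. A x + A (- x))" by simp
  show "AE x in lborel. norm (exp (- m * \<bar>x\<bar>)) \<le> norm (A x + A (- x))"
    by (intro AE_I2) (auto simp: A_def indicator_def abs_if)
qed measurable

text \<open>
  One Fermi factor decays at each end of the line: for \<open>x \<ge> 0\<close> the second one is used and the first is
  bounded by \<open>1\<close>, for \<open>x \<le> 0\<close> the other way round. The single bound yields convergence, the
  domination that makes the integral holomorphic, and the decay as \<open>Re w \<rightarrow> \<infinity>\<close>.
\<close>
lemma fd_integrand_bound:
  assumes \<alpha>: "\<alpha> > 0" and pq: "p \<ge> 0" "q \<ge> 0" and \<theta>: "\<theta> < pi"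
    and w: "p * \<bar>Im w\<bar> \<le> \<theta>" "q * \<bar>Im w\<bar> \<le> \<theta>"
  shows "norm (fermi (of_real p * w - of_real (x / \<alpha>)) * fermi (of_real q * w + of_real x))
    \<le> (exp (- p * Re w) + exp (- q * Re w)) * exp (- min 1 (1 / \<alpha>) * \<bar>x\<bar>) / (cos (\<theta> / 2))\<^sup>2"
proof -
  have "0 \<le> p * \<bar>Im w\<bar>" using pq by simp
  then have t0: "\<theta> \<ge> 0" using w by linarith
  have c: "cos (\<theta> / 2) > 0" using \<theta> t0 by (intro cos_gt_zero_pi) auto
  define A where "A = min 1 (exp (- (p * Re w - x / \<alpha>)))"
  define B where "B = min 1 (exp (- (q * Re w + x)))"
  have a: "norm (fermi (of_real p * w - of_real (x / \<alpha>))) \<le> A / cos (\<theta> / 2)"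
    using norm_fermi_le[of "of_real p * w - of_real (x / \<alpha>)" \<theta>] w \<theta> pq by (simp add: A_def abs_mult)
  have b: "norm (fermi (of_real q * w + of_real x)) \<le> B / cos (\<theta> / 2)"
    using norm_fermi_le[of "of_real q * w + of_real x" \<theta>] w \<theta> pq by (simp add: B_def abs_mult)
  have AB: "A * B \<le> (exp (- p * Re w) + exp (- q * Re w)) * exp (- min 1 (1 / \<alpha>) * \<bar>x\<bar>)"
  proof (cases "x \<ge> 0")
    case True
    have "A * B \<le> 1 * exp (- (q * Re w + x))"
      by (intro mult_mono) (auto simp: A_def B_def)
    also have "\<dots> = exp (- q * Re w) * exp (- x)" by (simp add: exp_add[symmetric])
    also have "\<dots> \<le> (exp (- p * Re w) + exp (- q * Re w)) * exp (- min 1 (1 / \<alpha>) * \<bar>x\<bar>)"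
    proof (intro mult_mono)
      have "min 1 (1 / \<alpha>) * \<bar>x\<bar> \<le> 1 * \<bar>x\<bar>" by (intro mult_right_mono) auto
      then show "exp (- x) \<le> exp (- min 1 (1 / \<alpha>) * \<bar>x\<bar>)" using True by simp
    qed auto
    finally show ?thesis .
  next
    case False
    have "A * B \<le> exp (- (p * Re w - x / \<alpha>)) * 1"
      by (intro mult_mono) (auto simp: A_def B_def)
    also have "\<dots> = exp (- p * Re w) * exp (x / \<alpha>)" by (simp add: exp_add[symmetric])
    also have "\<dots> \<le> (exp (- p * Re w) + exp (- q * Re w)) * exp (- min 1 (1 / \<alpha>) * \<bar>x\<bar>)"
    proof (intro mult_mono)
      have "min 1 (1 / \<alpha>) * \<bar>x\<bar> \<le> (1 / \<alpha>) * \<bar>x\<bar>" by (intro mult_right_mono) auto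
      then show "exp (x / \<alpha>) \<le> exp (- min 1 (1 / \<alpha>) * \<bar>x\<bar>)" using False by simp
    qed auto
    finally show ?thesis .
  qed
  have "norm (fermi (of_real p * w - of_real (x / \<alpha>)) * fermi (of_real q * w + of_real x))
      \<le> (A / cos (\<theta> / 2)) * (B / cos (\<theta> / 2))"
    unfolding norm_mult using c by (intro mult_mono a b) (auto simp: A_def)
  also have "\<dots> = A * B / (cos (\<theta> / 2))\<^sup>2" by (simp add: power2_eq_square)
  also have "\<dots> \<le> (exp (- p * Re w) + exp (- q * Re w)) * exp (- min 1 (1 / \<alpha>) * \<bar>x\<bar>) / (cos (\<theta> / 2))\<^sup>2"
    using AB by (intro divide_right_mono) auto
  finally show ?thesis .
qed

lemma fd_integrable:
  assumes \<alpha>: "\<alpha> > 0" and pq: "p \<ge> 0" "q \<ge> 0"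
    and w: "p * \<bar>Im w\<bar> < pi" "q * \<bar>Im w\<bar> < pi"
  shows "integrable lborel (\<lambda>x::real. fermi (of_real p * w - of_real (x / \<alpha>)) * fermi (of_real q * w + of_real x))"
proof (rule Bochner_Integration.integrable_bound)
  define \<theta> where "\<theta> = max (p * \<bar>Im w\<bar>) (q * \<bar>Im w\<bar>)"
  show "integrable lborel (\<lambda>x::real. (exp (- p * Re w) + exp (- q * Re w)) * exp (- min 1 (1 / \<alpha>) * \<bar>x\<bar>) / (cos (\<theta> / 2))\<^sup>2)"
    using \<alpha> by (intro integrable_divide integrable_mult_right integrable_exp_minus_abs) auto
  show "AE x in lborel. norm (fermi (of_real p * w - of_real (x / \<alpha>)) * fermi (of_real q * w + of_real x))
    \<le> norm ((exp (- p * Re w) + exp (- q * Re w)) * exp (- min 1 (1 / \<alpha>) * \<bar>x\<bar>) / (cos (\<theta> / 2))\<^sup>2)"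
    by (rule AE_I2, rule order_trans[OF fd_integrand_bound[where \<theta> = \<theta>]]) (use assms in \<open>auto simp: \<theta>_def\<close>)
qed measurable

lemma fd_int_bound:
  assumes \<alpha>: "\<alpha> > 0" and pq: "p \<ge> 0" "q \<ge> 0" and \<theta>: "\<theta> < pi"
  shows "\<exists>C>0. \<forall>w. p * \<bar>Im w\<bar> \<le> \<theta> \<longrightarrow> q * \<bar>Im w\<bar> \<le> \<theta> \<longrightarrow>
           norm (fd_int \<alpha> p q w) \<le> C * (exp (- p * Re w) + exp (- q * Re w))"
proof -
  define I where "I = (LINT x|lborel. exp (- min 1 (1 / \<alpha>) * \<bar>x::real\<bar>))"
  define C where "C = I / (cos (\<theta> / 2))\<^sup>2"
  have m: "min 1 (1 / \<alpha>) > 0" using \<alpha> by simp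
  have bd: "norm (fd_int \<alpha> p q w) \<le> C * (exp (- p * Re w) + exp (- q * Re w))"
    if w: "p * \<bar>Im w\<bar> \<le> \<theta>" "q * \<bar>Im w\<bar> \<le> \<theta>" for w
  proof -
    have "norm (fd_int \<alpha> p q w) \<le>
      (LINT x|lborel. (exp (- p * Re w) + exp (- q * Re w)) * exp (- min 1 (1 / \<alpha>) * \<bar>x\<bar>) / (cos (\<theta> / 2))\<^sup>2)"
      unfolding fd_int_def
    proof (rule Bochner_Integration.integral_norm_bound_integral)
      show "integrable lborel (\<lambda>x. fermi (of_real p * w - of_real (x / \<alpha>)) * fermi (of_real q * w + of_real x))"
        using w \<theta> by (intro fd_integrable \<alpha> pq) auto
      show "integrable lborel (\<lambda>x::real. (exp (- p * Re w) + exp (- q * Re w)) * exp (- min 1 (1 / \<alpha>) * \<bar>x\<bar>) / (cos (\<theta> / 2))\<^sup>2)"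
        using m by (intro integrable_divide integrable_mult_right integrable_exp_minus_abs)
    qed (rule fd_integrand_bound[OF \<alpha> pq \<theta> w])
    also have "\<dots> = C * (exp (- p * Re w) + exp (- q * Re w))" by (simp add: C_def I_def)
    finally show ?thesis .
  qed
  have "C * (exp (- p * Re w) + exp (- q * Re w)) \<le> (\<bar>C\<bar> + 1) * (exp (- p * Re w) + exp (- q * Re w))" for w
    by (intro mult_right_mono) auto
  then show ?thesis using bd by (intro exI[of _ "\<bar>C\<bar> + 1"]) (auto intro: order_trans)
qed

lemma fd_int_holomorphic:
  assumes \<alpha>: "\<alpha> > 0" and pq: "p \<ge> 0" "q \<ge> 0" and B: "p * B \<le> pi" "q * B \<le> pi"
    and pq0: "p > 0 \<or> q > 0"
  shows "fd_int \<alpha> p q holomorphic_on strip B"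
  unfolding fd_int_def
proof (rule holomorphic_on_parametric_integral[OF open_strip])
  have lt: "p * \<bar>Im w\<bar> < pi" "q * \<bar>Im w\<bar> < pi" if "w \<in> strip B" for w
  proof -
    have "p * \<bar>Im w\<bar> < pi" if "p > 0" using \<open>w \<in> strip B\<close> B(1) that
      by (metis less_le_trans mem_Collect_eq mult_less_cancel_left_pos strip_def)
    moreover have "q * \<bar>Im w\<bar> < pi" if "q > 0" using \<open>w \<in> strip B\<close> B(2) that
      by (metis less_le_trans mem_Collect_eq mult_less_cancel_left_pos strip_def)
    ultimately show "p * \<bar>Im w\<bar> < pi" "q * \<bar>Im w\<bar> < pi" using pq by (force simp: less_le)+
  qed
  show "(\<lambda>w. fermi (of_real p * w - of_real (x / \<alpha>)) * fermi (of_real q * w + of_real x)) holomorphic_on strip B" for x :: real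
    using lt pq by (intro holomorphic_intros) (auto simp: abs_mult)
  fix w0 assume w0: "w0 \<in> strip B"
  define b where "b = (B + \<bar>Im w0\<bar>) / 2"
  have b: "\<bar>Im w0\<bar> < b" "b < B" "b > 0" using w0 by (auto simp: b_def strip_def)
  define \<theta> where "\<theta> = max (p * b) (q * b)"
  have \<theta>: "\<theta> < pi" using lt[of "\<i> * of_real b"] b by (auto simp: \<theta>_def strip_def)
  define r where "r = min 1 (b - \<bar>Im w0\<bar>)"
  have r: "r > 0" using b by (simp add: r_def)
  define K where "K = exp (- p * (Re w0 - 1)) + exp (- q * (Re w0 - 1))"
  show "\<exists>r>0. \<exists>g. integrable lborel g \<and> (\<forall>w\<in>ball w0 r \<inter> strip B. \<forall>x.
     norm (fermi (of_real p * w - of_real (x / \<alpha>)) * fermi (of_real q * w + of_real x)) \<le> g x)"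
  proof (intro exI[of _ r] conjI r exI[of _ "\<lambda>x. K * exp (- min 1 (1 / \<alpha>) * \<bar>x\<bar>) / (cos (\<theta> / 2))\<^sup>2"] ballI allI)
    show "integrable lborel (\<lambda>x. K * exp (- min 1 (1 / \<alpha>) * \<bar>x\<bar>) / (cos (\<theta> / 2))\<^sup>2)"
      using \<alpha> by (intro integrable_divide integrable_mult_right integrable_exp_minus_abs) auto
    fix w x assume w: "w \<in> ball w0 r \<inter> strip B"
    have d: "\<bar>Im (w0 - w)\<bar> < r" "\<bar>Re (w0 - w)\<bar> < r"
      using w abs_Im_le_cmod[of "w0 - w"] abs_Re_le_cmod[of "w0 - w"] by (auto simp: dist_norm)
    have im: "\<bar>Im w\<bar> \<le> b" using d(1) by (auto simp: r_def)
    have re: "Re w \<ge> Re w0 - 1" using d(2) by (auto simp: r_def)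
    have th: "p * \<bar>Im w\<bar> \<le> \<theta>" "q * \<bar>Im w\<bar> \<le> \<theta>"
      using mult_left_mono[OF im pq(1)] mult_left_mono[OF im pq(2)] by (auto simp: \<theta>_def)
    have "norm (fermi (of_real p * w - of_real (x / \<alpha>)) * fermi (of_real q * w + of_real x))
       \<le> (exp (- p * Re w) + exp (- q * Re w)) * exp (- min 1 (1 / \<alpha>) * \<bar>x\<bar>) / (cos (\<theta> / 2))\<^sup>2"
      by (rule fd_integrand_bound[OF \<alpha> pq \<theta> th])
    also have "\<dots> \<le> K * exp (- min 1 (1 / \<alpha>) * \<bar>x\<bar>) / (cos (\<theta> / 2))\<^sup>2"
    proof (intro divide_right_mono mult_right_mono)
      have "p * (Re w0 - 1) \<le> p * Re w" "q * (Re w0 - 1) \<le> q * Re w"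
        using re pq by (auto intro: mult_left_mono)
      then show "exp (- p * Re w) + exp (- q * Re w) \<le> K" unfolding K_def by (intro add_mono) auto
    qed auto
    finally show "norm (fermi (of_real p * w - of_real (x / \<alpha>)) * fermi (of_real q * w + of_real x))
       \<le> K * exp (- min 1 (1 / \<alpha>) * \<bar>x\<bar>) / (cos (\<theta> / 2))\<^sup>2" .
  qed
qed measurable

text \<open>
  On the real axis the distribution of the argument does not matter as long as \<open>p + q/\<alpha> = 1\<close>, because
  the substitution \<open>x \<mapsto> q s + x\<close> moves between the two forms.
\<close>
lemma fd_int_of_real:
  assumes "\<alpha> > 0" "p + q / \<alpha> = 1"
  shows "fd_int \<alpha> p q (of_real s) = fd_int \<alpha> 1 0 (of_real s)"
proof -
  have p: "p = 1 - q / \<alpha>" using assms by simp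
  have "fd_int \<alpha> 1 0 (of_real s) = (LINT x|lborel. fermi (of_real s - of_real ((q * s + 1 * x) / \<alpha>)) * fermi (of_real (q * s + 1 * x)))"
    unfolding fd_int_def by (subst lborel_integral_real_affine[of 1 _ "q * s"]) auto
  also have "\<dots> = fd_int \<alpha> p q (of_real s)"
    unfolding fd_int_def p using assms(1)
    by (intro Bochner_Integration.integral_cong) (auto simp: algebra_simps add_divide_distrib)
  finally show ?thesis ..
qed

text \<open>
  The balanced distribution, for which the conditions \<open>p |Im w| < \<pi>\<close> and \<open>q |Im w| < \<pi>\<close> become
  one and the strip of convergence is the widest: \<open>|Im w| < \<pi> + \<pi>/\<alpha>\<close>.
\<close>
definition F_ext :: "real \<Rightarrow> complex \<Rightarrow> complex" where
  "F_ext \<alpha> = fd_int \<alpha> (\<alpha> / (\<alpha> + 1)) (\<alpha> / (\<alpha> + 1))"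

lemma balanced_weight:
  fixes \<alpha> :: real
  assumes "\<alpha> > 0"
  shows "\<alpha> / (\<alpha> + 1) > 0" "\<alpha> / (\<alpha> + 1) + \<alpha> / (\<alpha> + 1) / \<alpha> = 1"
    "\<alpha> / (\<alpha> + 1) * (pi + pi / \<alpha>) = pi"
proof -
  show "\<alpha> / (\<alpha> + 1) > 0" using assms by simp
  have "\<alpha> / (\<alpha> + 1) + \<alpha> / (\<alpha> + 1) / \<alpha> = (\<alpha> + 1) / (\<alpha> + 1)"
    using assms by (simp only: add_divide_distrib) simp
  then show *: "\<alpha> / (\<alpha> + 1) + \<alpha> / (\<alpha> + 1) / \<alpha> = 1" using assms by simp
  have "\<alpha> / (\<alpha> + 1) * (pi + pi / \<alpha>) = (\<alpha> / (\<alpha> + 1) + \<alpha> / (\<alpha> + 1) / \<alpha>) * pi"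
    by (simp only: distrib_left distrib_right) (simp only: times_divide_eq_right times_divide_eq_left)
  then show "\<alpha> / (\<alpha> + 1) * (pi + pi / \<alpha>) = pi" unfolding * by simp
qed

lemma F_ext_holomorphic: "\<alpha> > 0 \<Longrightarrow> F_ext \<alpha> holomorphic_on strip (pi + pi / \<alpha>)"
  unfolding F_ext_def using balanced_weight by (intro fd_int_holomorphic) (auto intro: less_imp_le)

lemma F_ext_of_real: "\<alpha> > 0 \<Longrightarrow> F_ext \<alpha> (of_real s) = fd_int \<alpha> 1 0 (of_real s)"
  unfolding F_ext_def using balanced_weight by (intro fd_int_of_real) auto

lemma F_ext_eq_fd_int:
  assumes "\<alpha> > 0" "\<bar>Im w\<bar> < pi"
  shows "F_ext \<alpha> w = fd_int \<alpha> 1 0 w"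
proof (rule strip_identity[of "F_ext \<alpha>" pi "fd_int \<alpha> 1 0" w])
  have "strip (pi) \<subseteq> strip (pi + pi / \<alpha>)"
    using assms by (auto simp: strip_def intro: less_le_trans)
  then show "F_ext \<alpha> holomorphic_on strip (pi)"
    using F_ext_holomorphic[OF assms(1)] holomorphic_on_subset by blast
  show "fd_int \<alpha> 1 0 holomorphic_on strip pi"
    by (rule fd_int_holomorphic) (use assms in auto)
qed (use assms in \<open>auto simp: strip_def F_ext_of_real\<close>)

lemma F_ext_eq_F_int:
  assumes "\<alpha> > 0" "\<bar>Im w\<bar> < pi"
  shows "F_ext \<alpha> w = F_int \<alpha> w"
  unfolding F_ext_eq_fd_int[OF assms] fd_int_def F_int_def fermi_def
  by (simp add: exp_of_real)

lemma F_ext_eq_dual: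
  assumes "\<alpha> > 0" "\<bar>Im w\<bar> < pi / \<alpha>"
  shows "F_ext \<alpha> w = fd_int \<alpha> 0 \<alpha> w"
proof (rule strip_identity[of "F_ext \<alpha>" "pi / \<alpha>" "fd_int \<alpha> 0 \<alpha>" w])
  have "strip (pi / \<alpha>) \<subseteq> strip (pi + pi / \<alpha>)"
    using assms by (auto simp: strip_def intro: less_le_trans)
  then show "F_ext \<alpha> holomorphic_on strip (pi / \<alpha>)"
    using F_ext_holomorphic[OF assms(1)] holomorphic_on_subset by blast
  show "fd_int \<alpha> 0 \<alpha> holomorphic_on strip (pi / \<alpha>)"
    by (rule fd_int_holomorphic) (use assms in auto)
  show "F_ext \<alpha> (of_real s) = fd_int \<alpha> 0 \<alpha> (of_real s)" for s
    unfolding F_ext_of_real[OF assms(1)] using assms by (subst fd_int_of_real[of \<alpha> 0 \<alpha>]) auto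
qed (use assms in \<open>auto simp: strip_def\<close>)

lemma F_ext_bound:
  assumes "\<alpha> > 0" "b < pi + pi / \<alpha>"
  shows "\<exists>C>0. \<forall>w. \<bar>Im w\<bar> \<le> b \<longrightarrow> norm (F_ext \<alpha> w) \<le> C * exp (- (\<alpha> / (\<alpha> + 1)) * Re w)"
proof -
  define c where "c = \<alpha> / (\<alpha> + 1)"
  have c: "c > 0" using assms by (simp add: c_def)
  have "c * b < c * (pi + pi / \<alpha>)" using assms c by simp
  then have "c * b < pi" using balanced_weight(3)[OF assms(1)] by (simp add: c_def)
  from fd_int_bound[OF assms(1) _ _ this, of c c] c
  obtain C where C: "C > 0" "\<And>w. c * \<bar>Im w\<bar> \<le> c * b \<Longrightarrow> norm (fd_int \<alpha> c c w) \<le> C * (exp (- c * Re w) + exp (- c * Re w))"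
    by auto
  show ?thesis
  proof (intro exI[of _ "2 * C"] conjI allI impI)
    fix w assume "\<bar>Im w\<bar> \<le> b"
    then have "c * \<bar>Im w\<bar> \<le> c * b" using c by simp
    from C(2)[OF this] show "norm (F_ext \<alpha> w) \<le> 2 * C * exp (- (\<alpha> / (\<alpha> + 1)) * Re w)"
      by (simp add: F_ext_def c_def)
  qed (use C in auto)
qed

section \<open>Functional equations of the integral\<close>

text \<open>
  The substitution \<open>x \<mapsto> - x/\<alpha>\<close> exchanges the two Fermi factors, and the balanced proportions of
  \<open>\<alpha>\<close> and \<open>1/\<alpha>\<close> correspond: \<open>(1/\<alpha>) / (1/\<alpha> + 1) \<cdot> \<alpha> = \<alpha> / (\<alpha> + 1)\<close>. So this identity holds without
  any continuation argument.
\<close>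
lemma F_ext_duality:
  assumes "\<alpha> > 0"
  shows "F_ext \<alpha> w = of_real \<alpha> * F_ext (1 / \<alpha>) (of_real \<alpha> * w)"
proof -
  have c: "complex_of_real ((1 / \<alpha>) / (1 / \<alpha> + 1)) * (of_real \<alpha> * w) = of_real (\<alpha> / (\<alpha> + 1)) * w"
    using assms by (simp add: field_simps)
  have "F_ext (1 / \<alpha>) (of_real \<alpha> * w) =
     (LINT x|lborel. fermi (of_real (\<alpha> / (\<alpha> + 1)) * w - of_real (x * \<alpha>)) * fermi (of_real (\<alpha> / (\<alpha> + 1)) * w + of_real x))"
    unfolding F_ext_def fd_int_def c by simp
  also have "\<dots> = of_real (1 / \<alpha>) * F_ext \<alpha> w"
    using assms
    by (subst lborel_integral_real_affine[of "- (1 / \<alpha>)" _ 0])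
       (auto simp: F_ext_def fd_int_def mult.commute scaleR_conv_of_real)
  finally show ?thesis using assms by simp
qed

lemma fermi_of_real: "fermi (of_real r) = of_real (1 / (1 + exp r))"
  by (simp add: fermi_def exp_of_real)

lemma one_plus_exp_of_real_neq_0: "1 + exp (complex_of_real r) \<noteq> 0"
  by (rule one_plus_exp_neq_0) simp

text \<open>
  From \<open>1 / (1 + e^(-v)) = 1 - 1 / (1 + e^v)\<close>, the substitution \<open>x \<mapsto> - x\<close> turns the product \<open>a b\<close> of the
  two factors into \<open>(1 - a) (1 - b)\<close>. The difference \<open>1 - a - b\<close> has the elementary primitive \<open>P\<close> of
  the proof, which tends to \<open>0\<close> at \<open>-\<infinity>\<close> and to \<open>\<alpha> s\<close> at \<open>\<infinity>\<close>.
\<close>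
lemma fd_int_minus_of_real:
  fixes \<alpha> s :: real
  assumes \<alpha>: "\<alpha> > 0"
  shows "fd_int \<alpha> 1 0 (of_real (- s)) = fd_int \<alpha> 1 0 (of_real s) + of_real (\<alpha> * s)"
proof -
  define h where "h s x = fermi (of_real s - of_real (x / \<alpha>)) * fermi (of_real x)" for s x :: real
  define g where "g x = 1 - 1 / (1 + exp (s - x / \<alpha>)) - 1 / (1 + exp x)" for x
  define P where "P x = ln (1 + exp x) - \<alpha> * ln (1 + exp (x / \<alpha> - s))" for x
  have int: "integrable lborel (h s)" for s
    unfolding h_def using fd_integrable[of \<alpha> 1 0 "of_real s"] \<alpha> by simp
  have F: "fd_int \<alpha> 1 0 (of_real s) = (LINT x|lborel. h s x)" for s
    unfolding fd_int_def h_def by simp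
  have hm: "integrable lborel (\<lambda>x. h (- s) (- x))"
    using lborel_integrable_real_affine[OF int[of "-s"], of "-1" 0] by simp
  have eq: "h (- s) (- x) - h s x = of_real (g x)" for x
  proof -
    have e: "of_real (- s) - of_real (- x / \<alpha>) = of_real (- (s - x / \<alpha>))"
            "complex_of_real s - of_real (x / \<alpha>) = of_real (s - x / \<alpha>)" by simp_all
    have "1 / (1 + exp (- (s - x / \<alpha>))) * (1 / (1 + exp (- x))) - 1 / (1 + exp (s - x / \<alpha>)) * (1 / (1 + exp x)) = g x"
    proof -
      have "1 / (1 + exp (- v)) = 1 - 1 / (1 + exp v)" for v :: real
      proof -
        define E where "E = exp v"
        have "E > 0" by (simp add: E_def)
        then have "1 / (1 + 1 / E) = 1 - 1 / (1 + E)" by (simp add: divide_simps)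
        then show ?thesis by (simp add: E_def exp_minus inverse_eq_divide)
      qed
      note * = this
      have gen: "(1 - A) * (1 - B) - A * B = 1 - A - B" for A B :: real by (simp add: algebra_simps)
      show ?thesis unfolding * g_def by (rule gen)
    qed
    then show ?thesis
      unfolding h_def e fermi_of_real by (simp only: of_real_mult[symmetric] of_real_diff[symmetric])
  qed
  have gint: "integrable lborel g"
  proof -
    have "integrable lborel (\<lambda>x. Re (h (- s) (- x) - h s x))"
      by (intro integrable_Re Bochner_Integration.integrable_diff hm int)
    then show ?thesis unfolding eq by simp
  qed
  have "(LBINT x=-\<infinity>..\<infinity>. g x) = \<alpha> * s - 0"
  proof (rule interval_integral_FTC_integrable)
    show "(P has_vector_derivative g x) (at x)" for x
    proof -
      have "(P has_real_derivative (exp x / (1 + exp x) - exp (x / \<alpha> - s) / (1 + exp (x / \<alpha> - s)))) (at x)"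
        unfolding P_def using \<alpha> by (auto intro!: derivative_eq_intros simp: add_pos_pos)
      also have "exp x / (1 + exp x) - exp (x / \<alpha> - s) / (1 + exp (x / \<alpha> - s)) = g x"
      proof -
        have "exp x / (1 + exp x) = 1 - 1 / (1 + exp x)"
        proof -
          have "1 + exp x \<noteq> 0" using exp_gt_zero[of x] by linarith
          then show ?thesis by (simp add: divide_simps)
        qed
        moreover have "exp (- v) / (1 + exp (- v)) = 1 / (1 + exp v)" for v :: real
        proof -
          define E where "E = exp v"
          have "E > 0" by (simp add: E_def)
          then have "1 / E / (1 + 1 / E) = 1 / (1 + E)" by (simp add: divide_simps)
          then show ?thesis by (simp add: E_def exp_minus inverse_eq_divide)
        qed
        from this[of "s - x / \<alpha>"] have "exp (x / \<alpha> - s) / (1 + exp (x / \<alpha> - s)) = 1 / (1 + exp (s - x / \<alpha>))" by simp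
        ultimately show ?thesis by (simp add: g_def)
      qed
      finally show ?thesis by (simp add: has_real_derivative_iff_has_vector_derivative)
    qed
    show "isCont g x" for x unfolding g_def
      using \<alpha> by (intro continuous_intros) (auto simp: add_pos_pos less_imp_neq[symmetric] pos_add_strict)
    show "set_integrable lborel (einterval (-\<infinity>) \<infinity>) g"
      using gint by (simp add: set_integrable_def)
    have "(P \<longlongrightarrow> 0) at_bot" unfolding P_def using \<alpha> by real_asymp
    then show "((P \<circ> real_of_ereal) \<longlongrightarrow> 0) (at_right (-\<infinity>))" by (simp add: ereal_tendsto_simps)
    have "(P \<longlongrightarrow> \<alpha> * s) at_top" unfolding P_def using \<alpha> by real_asymp
    then show "((P \<circ> real_of_ereal) \<longlongrightarrow> \<alpha> * s) (at_left \<infinity>)" by (simp add: ereal_tendsto_simps)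
  qed auto
  then have gval: "(LINT x|lborel. g x) = \<alpha> * s"
    by (simp add: interval_lebesgue_integral_def set_lebesgue_integral_def)
  have "fd_int \<alpha> 1 0 (of_real (- s)) = (LINT x|lborel. h (- s) (- x))"
    unfolding F by (subst lborel_integral_real_affine[of "-1" _ 0]) auto
  then have "fd_int \<alpha> 1 0 (of_real (- s)) - fd_int \<alpha> 1 0 (of_real s) = (LINT x|lborel. h (- s) (- x) - h s x)"
    unfolding F[of s] using hm int by simp
  also have "\<dots> = of_real (\<alpha> * s)" unfolding eq integral_complex_of_real gval by simp
  finally show ?thesis by (simp add: algebra_simps)
qed

lemma holomorphic_on_F_ext:
  assumes "\<alpha> > 0" "f holomorphic_on A" "\<And>z. z \<in> A \<Longrightarrow> \<bar>Im (f z)\<bar> < pi + pi / \<alpha>"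
  shows "(\<lambda>z. F_ext \<alpha> (f z)) holomorphic_on A"
  using holomorphic_on_compose_gen[OF assms(2) F_ext_holomorphic[OF assms(1)]] assms(3)
  by (auto simp: o_def strip_def image_subset_iff)

lemma F_ext_reflection:
  assumes "\<alpha> > 0" "\<bar>Im w\<bar> < pi + pi / \<alpha>"
  shows "F_ext \<alpha> (- w) = F_ext \<alpha> w + of_real \<alpha> * w"
proof (rule strip_identity[of "\<lambda>w. F_ext \<alpha> (- w)" "pi + pi / \<alpha>" "\<lambda>w. F_ext \<alpha> w + of_real \<alpha> * w" w])
  show "(\<lambda>w. F_ext \<alpha> (- w)) holomorphic_on strip (pi + pi / \<alpha>)"
    by (intro holomorphic_on_F_ext assms holomorphic_intros) (auto simp: strip_def)
  show "(\<lambda>w. F_ext \<alpha> w + of_real \<alpha> * w) holomorphic_on strip (pi + pi / \<alpha>)"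
    using F_ext_holomorphic[OF assms(1)] by (intro holomorphic_intros)
  show "F_ext \<alpha> (- of_real s) = F_ext \<alpha> (of_real s) + of_real \<alpha> * of_real s" for s
    using F_ext_of_real[OF assms(1), of s] F_ext_of_real[OF assms(1), of "-s"]
      fd_int_minus_of_real[OF assms(1), of s] by simp
qed (use assms in \<open>auto simp: strip_def\<close>)

text \<open>
  As \<open>\<theta>\<close> tends to \<open>\<pi>\<close> this difference becomes a multiple of a Dirac mass at \<open>t = 0\<close>, caused by the pole of the
  Fermi factor at \<open>\<pi> i\<close>. It is written in terms of \<open>\<sigma> = cos (\<theta>/2)\<close>, which tends to \<open>0\<close>, so that the
  scaling \<open>t = 2 \<sigma> r\<close> makes it comparable with the Cauchy density \<open>1 / (1 + r^2)\<close>.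
\<close>
lemma fermi_jump_kernel:
  fixes t \<theta> :: real
  assumes "0 < \<theta>" "\<theta> < pi"
  shows "fermi (of_real t + \<i> * of_real \<theta>) - fermi (of_real t - \<i> * of_real \<theta>) =
    - \<i> * of_real (sin (\<theta> / 2) * cos (\<theta> / 2) / ((sinh (t / 2))\<^sup>2 + (cos (\<theta> / 2))\<^sup>2))"
proof -
  define E where "E = complex_of_real (exp t)"
  define a where "a = cis \<theta>"
  define b where "b = cis (- \<theta>)"
  have ab: "a * b = 1" by (simp add: a_def b_def cis_mult)
  have ea: "exp (of_real t + \<i> * of_real \<theta>) = E * a" "exp (of_real t - \<i> * of_real \<theta>) = E * b"
    by (simp_all add: E_def a_def b_def exp_add exp_diff exp_of_real cis_conv_exp exp_minus divide_inverse)
  have n0: "1 + E * a \<noteq> 0" "1 + E * b \<noteq> 0"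
    unfolding ea[symmetric] by (rule one_plus_exp_neq_0; use assms in simp)+
  have sum: "a + b = of_real (2 * cos \<theta>)" and diff: "b - a = of_real (2 * sin \<theta>) * (- \<i>)"
    by (auto simp: a_def b_def complex_eq_iff)
  have "(1 + E * a) * (1 + E * b) = 1 + E * (a + b) + E * E * (a * b)" by (simp add: algebra_simps)
  also have "\<dots> = of_real (1 + exp t * (2 * cos \<theta>) + exp t * exp t)"
    unfolding ab sum by (simp add: E_def)
  also have "1 + exp t * (2 * cos \<theta>) + exp t * exp t = exp t * (4 * ((sinh (t / 2))\<^sup>2 + (cos (\<theta> / 2))\<^sup>2))"
  proof -
    have c: "cos \<theta> = 2 * (cos (\<theta> / 2))\<^sup>2 - 1" using cos_double_cos[of "\<theta> / 2"] by simp
    define y where "y = exp (t / 2)"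
    have y: "y > 0" "exp t = y\<^sup>2" by (auto simp: y_def power2_eq_square exp_add[symmetric])
    have s: "sinh (t / 2) = (y - 1 / y) / 2" by (simp add: sinh_def y_def exp_minus field_simps)
    show ?thesis unfolding c s y(2) using y(1) by (simp add: field_simps power2_eq_square)
  qed
  finally have den: "(1 + E * a) * (1 + E * b) = E * of_real (4 * ((sinh (t / 2))\<^sup>2 + (cos (\<theta> / 2))\<^sup>2))"
    by (simp add: E_def)
  have "fermi (of_real t + \<i> * of_real \<theta>) - fermi (of_real t - \<i> * of_real \<theta>) =
    E * (b - a) / ((1 + E * a) * (1 + E * b))"
    unfolding fermi_def ea using n0 by (simp add: field_simps)
  also have "\<dots> = - \<i> * of_real (2 * sin \<theta> / (4 * ((sinh (t / 2))\<^sup>2 + (cos (\<theta> / 2))\<^sup>2)))"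
    unfolding den diff by (simp add: E_def)
  also have "2 * sin \<theta> = 4 * (sin (\<theta> / 2) * cos (\<theta> / 2))" using sin_double[of "\<theta> / 2"] by simp
  also have "4 * (sin (\<theta> / 2) * cos (\<theta> / 2)) / (4 * ((sinh (t / 2))\<^sup>2 + (cos (\<theta> / 2))\<^sup>2)) =
      sin (\<theta> / 2) * cos (\<theta> / 2) / ((sinh (t / 2))\<^sup>2 + (cos (\<theta> / 2))\<^sup>2)"
    by (rule mult_divide_mult_cancel_left) simp
  finally show ?thesis .
qed

lemma abs_le_abs_sinh: "\<bar>x\<bar> \<le> \<bar>sinh x\<bar>" for x :: real
proof -
  have *: "y \<le> sinh y" if "y \<ge> 0" for y :: real
  proof -
    have "sinh 0 - 0 \<le> sinh y - y"
      using that by (intro DERIV_nonneg_imp_nondecreasing[of 0 y "\<lambda>x. sinh x - x"])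
        (auto intro!: exI derivative_eq_intros simp: cosh_real_ge_1)
    then show ?thesis by simp
  qed
  show ?thesis using *[of x] *[of "- x"] by (cases "x \<ge> 0") auto
qed

lemma integrable_inverse_1_plus_square_UNIV:
  "integrable lborel (\<lambda>x::real. 1 / (1 + x\<^sup>2))" "(LINT x|lborel. 1 / (1 + x\<^sup>2::real)) = pi"
  using integrable_inverse_1_plus_square LBINT_inverse_1_plus_square
  by (simp_all add: set_integrable_def interval_lebesgue_integral_def set_lebesgue_integral_def inverse_eq_divide)

text \<open>
  The substitution is \<open>x = \<alpha> s - 2 \<alpha> \<sigma> r\<close> with \<open>\<sigma> = cos (\<theta>/2)\<close>: it maps the argument \<open>s - x/\<alpha>\<close> of the kernel
  to \<open>2 \<sigma> r\<close>, which is the scale on which the kernel has a limit.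
\<close>
lemma fd_int_jump_kernel:
  fixes \<alpha> s \<theta> :: real
  assumes \<alpha>: "\<alpha> > 0" and \<theta>: "0 < \<theta>" "\<theta> < pi"
  shows "fd_int \<alpha> 1 0 (of_real s + \<i> * of_real \<theta>) - fd_int \<alpha> 1 0 (of_real s - \<i> * of_real \<theta>) =
    - 2 * \<i> * of_real \<alpha> * (LINT r|lborel.
       of_real (sin (\<theta> / 2) * (cos (\<theta> / 2))\<^sup>2 / ((sinh (cos (\<theta> / 2) * r))\<^sup>2 + (cos (\<theta> / 2))\<^sup>2)) *
       fermi (of_real (\<alpha> * s - 2 * \<alpha> * cos (\<theta> / 2) * r)))"
proof -
  define \<sigma> where "\<sigma> = cos (\<theta> / 2)"
  have \<sigma>: "\<sigma> > 0" using \<theta> by (auto simp: \<sigma>_def intro!: cos_gt_zero_pi)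
  define K where "K t = - \<i> * of_real (sin (\<theta> / 2) * \<sigma> / ((sinh (t / 2))\<^sup>2 + \<sigma>\<^sup>2))" for t
  have int: "integrable lborel (\<lambda>x. fermi (of_real s + \<i> * of_real y - of_real (x / \<alpha>)) * fermi (of_real x))"
    if "\<bar>y\<bar> < pi" for y
    using fd_integrable[of \<alpha> 1 0 "of_real s + \<i> * of_real y"] \<alpha> that by simp
  have "fd_int \<alpha> 1 0 (of_real s + \<i> * of_real \<theta>) - fd_int \<alpha> 1 0 (of_real s - \<i> * of_real \<theta>) =
    (LINT x|lborel. fermi (of_real s + \<i> * of_real \<theta> - of_real (x / \<alpha>)) * fermi (of_real x)
       - fermi (of_real s - \<i> * of_real \<theta> - of_real (x / \<alpha>)) * fermi (of_real x))"
    using int[of \<theta>] int[of "-\<theta>"] \<theta> by (simp add: fd_int_def)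
  also have "\<dots> = (LINT x|lborel. K (s - x / \<alpha>) * fermi (of_real x))"
  proof (rule Bochner_Integration.integral_cong)
    fix x
    have "fermi (of_real s + \<i> * of_real \<theta> - of_real (x / \<alpha>)) - fermi (of_real s - \<i> * of_real \<theta> - of_real (x / \<alpha>)) = K (s - x / \<alpha>)"
      using fermi_jump_kernel[OF \<theta>, of "s - x / \<alpha>"] by (simp add: K_def \<sigma>_def algebra_simps)
    then show "fermi (of_real s + \<i> * of_real \<theta> - of_real (x / \<alpha>)) * fermi (of_real x)
       - fermi (of_real s - \<i> * of_real \<theta> - of_real (x / \<alpha>)) * fermi (of_real x) = K (s - x / \<alpha>) * fermi (of_real x)"
      by (simp only: left_diff_distrib[symmetric])
  qed simp
  also have "\<dots> = of_real (2 * \<alpha> * \<sigma>) * (LINT r|lborel. K (s - (\<alpha> * s + (- 2 * \<alpha> * \<sigma>) * r) / \<alpha>) * fermi (of_real (\<alpha> * s + (- 2 * \<alpha> * \<sigma>) * r)))"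
    using \<alpha> \<sigma> by (subst lborel_integral_real_affine[of "- 2 * \<alpha> * \<sigma>" _ "\<alpha> * s"]) (auto simp: scaleR_conv_of_real abs_mult)
  also have "(\<lambda>r. K (s - (\<alpha> * s + (- 2 * \<alpha> * \<sigma>) * r) / \<alpha>)) = (\<lambda>r. K (2 * (\<sigma> * r)))"
    using \<alpha> by (auto simp: add_divide_distrib diff_divide_distrib)
  also have "(LINT r|lborel. K (2 * (\<sigma> * r)) * fermi (of_real (\<alpha> * s + (- 2 * \<alpha> * \<sigma>) * r))) =
     (LINT r|lborel. (- \<i> / of_real \<sigma>) * (of_real (sin (\<theta> / 2) * \<sigma>\<^sup>2 / ((sinh (\<sigma> * r))\<^sup>2 + \<sigma>\<^sup>2)) *
       fermi (of_real (\<alpha> * s - 2 * \<alpha> * \<sigma> * r))))"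
    using \<sigma> by (intro Bochner_Integration.integral_cong) (auto simp: K_def power2_eq_square)
  also have "of_real (2 * \<alpha> * \<sigma>) * \<dots> = - 2 * \<i> * of_real \<alpha> * (LINT r|lborel. (of_real (sin (\<theta> / 2) * \<sigma>\<^sup>2 / ((sinh (\<sigma> * r))\<^sup>2 + \<sigma>\<^sup>2)) *
       fermi (of_real (\<alpha> * s - 2 * \<alpha> * \<sigma> * r))))"
    using \<sigma> by (simp only: integral_mult_right_zero) simp
  finally show ?thesis unfolding \<sigma>_def .
qed

text \<open>
  After the scaling, \<open>sinh (\<sigma> r) \<ge> \<sigma> r\<close> in absolute value gives the integrable bound
  \<open>1 / (1 + r^2)\<close>, which is also the limit of the kernel. Its total mass \<open>\<pi>\<close> accounts for the factor
  \<open>\<pi>\<close> on the right.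
\<close>
lemma F_ext_jump_of_real:
  fixes \<alpha> s :: real
  assumes \<alpha>: "\<alpha> > 0"
  shows "F_ext \<alpha> (of_real s + \<i> * of_real pi) - F_ext \<alpha> (of_real s - \<i> * of_real pi) =
    - 2 * \<i> * of_real \<alpha> * of_real pi * fermi (of_real (\<alpha> * s))"
proof -
  \<comment> \<open>The boundary lines \<open>Im w = \<plusminus>\<pi>\<close> are approached from inside, where the original integral applies.\<close>
  define \<theta> where "\<theta> n = pi - 1 / real (Suc n)" for n
  define \<sigma> where "\<sigma> n = cos (\<theta> n / 2)" for n
  define k where "k n r = sin (\<theta> n / 2) * (\<sigma> n)\<^sup>2 / ((sinh (\<sigma> n * r))\<^sup>2 + (\<sigma> n)\<^sup>2)" for n r
  define f where "f n r = of_real (k n r) * fermi (of_real (\<alpha> * s - 2 * \<alpha> * \<sigma> n * r))" for n r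
  have \<theta>: "0 < \<theta> n" "\<theta> n < pi" for n
  proof -
    have "1 / real (Suc n) \<le> 1" by simp
    then show "0 < \<theta> n" using pi_gt3 unfolding \<theta>_def by linarith
    show "\<theta> n < pi" by (simp add: \<theta>_def)
  qed
  have \<sigma>: "\<sigma> n > 0" for n
    unfolding \<sigma>_def by (intro cos_gt_zero_pi) (use \<theta>[of n] in auto)
  have "\<theta> \<longlonglongrightarrow> pi - 0" unfolding \<theta>_def by (intro tendsto_intros LIMSEQ_Suc lim_1_over_n)
  then have \<theta>lim: "\<theta> \<longlonglongrightarrow> pi" by simp
  have "\<sigma> \<longlonglongrightarrow> cos (pi / 2)" unfolding \<sigma>_def by (intro tendsto_intros \<theta>lim) auto
  then have \<sigma>lim: "\<sigma> \<longlonglongrightarrow> 0" by simp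
  have klim: "(\<lambda>n. k n r) \<longlonglongrightarrow> 1 / (1 + r\<^sup>2)" for r
  proof -
    have "((\<lambda>x::real. sinh (x * r) / x) \<longlongrightarrow> r) (at 0)"
    proof -
      have "((\<lambda>x. sinh (x * r)) has_real_derivative cosh (0 * r) * r) (at 0)"
        by (auto intro!: derivative_eq_intros)
      then show ?thesis by (simp add: has_field_derivative_iff)
    qed
    moreover have "filterlim \<sigma> (at 0) sequentially"
      using \<sigma>lim \<sigma> by (auto simp: filterlim_at less_imp_neq[symmetric])
    ultimately have "(\<lambda>n. sinh (\<sigma> n * r) / \<sigma> n) \<longlonglongrightarrow> r" by (rule filterlim_compose)
    moreover have "(\<lambda>n. sin (\<theta> n / 2)) \<longlonglongrightarrow> sin (pi / 2)" by (intro tendsto_intros \<theta>lim) auto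
    ultimately have "(\<lambda>n. sin (\<theta> n / 2) / ((sinh (\<sigma> n * r) / \<sigma> n)\<^sup>2 + 1)) \<longlonglongrightarrow> sin (pi / 2) / (r\<^sup>2 + 1)"
      by (intro tendsto_divide tendsto_add tendsto_power tendsto_const) (auto simp: add_nonneg_eq_0_iff)
    moreover have "sin (\<theta> n / 2) / ((sinh (\<sigma> n * r) / \<sigma> n)\<^sup>2 + 1) = k n r" for n
      using \<sigma>[of n] unfolding k_def by (simp add: power_divide divide_simps)
    ultimately show ?thesis by (simp add: add.commute)
  qed
  have kbd: "\<bar>k n r\<bar> \<le> 1 / (1 + r\<^sup>2)" for n r
  proof -
    have "(\<sigma> n * r)\<^sup>2 \<le> (sinh (\<sigma> n * r))\<^sup>2" using abs_le_abs_sinh abs_le_square_iff by blast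
    then have "(\<sigma> n)\<^sup>2 * (1 + r\<^sup>2) \<le> (sinh (\<sigma> n * r))\<^sup>2 + (\<sigma> n)\<^sup>2" by (simp add: power_mult_distrib algebra_simps)
    moreover have "(\<sigma> n)\<^sup>2 * (1 + r\<^sup>2) > 0" using \<sigma>[of n] by (intro mult_pos_pos) (auto simp: add_pos_nonneg)
    moreover have "\<bar>sin (\<theta> n / 2) * (\<sigma> n)\<^sup>2\<bar> \<le> 1 * (\<sigma> n)\<^sup>2"
      unfolding abs_mult by (intro mult_mono) auto
    ultimately have "\<bar>k n r\<bar> \<le> (\<sigma> n)\<^sup>2 / ((\<sigma> n)\<^sup>2 * (1 + r\<^sup>2))"
      unfolding k_def abs_divide by (intro frac_le) auto
    then show ?thesis using \<sigma>[of n] by simp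
  qed
  have "(\<lambda>n. LINT r|lborel. f n r) \<longlonglongrightarrow> (LINT r|lborel. of_real (1 / (1 + r\<^sup>2)) * fermi (of_real (\<alpha> * s)))"
  proof (rule integral_dominated_convergence)
    show "integrable lborel (\<lambda>x::real. 1 / (1 + x\<^sup>2))" by (rule integrable_inverse_1_plus_square_UNIV)
    show "AE r in lborel. (\<lambda>n. f n r) \<longlonglongrightarrow> of_real (1 / (1 + r\<^sup>2)) * fermi (of_real (\<alpha> * s))"
    proof (rule AE_I2)
      fix r
      have "(\<lambda>n. 1 / (1 + exp (complex_of_real (\<alpha> * s - 2 * \<alpha> * \<sigma> n * r)))) \<longlonglongrightarrow> 1 / (1 + exp (of_real (\<alpha> * s - 2 * \<alpha> * 0 * r)))"
        by (intro tendsto_intros \<sigma>lim one_plus_exp_of_real_neq_0)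
      then show "(\<lambda>n. f n r) \<longlonglongrightarrow> of_real (1 / (1 + r\<^sup>2)) * fermi (of_real (\<alpha> * s))"
        unfolding f_def fermi_def by (intro tendsto_mult tendsto_of_real klim) simp
    qed
    show "AE r in lborel. norm (f n r) \<le> 1 / (1 + r\<^sup>2)" for n
    proof (rule AE_I2)
      fix r
      have "norm (f n r) = \<bar>k n r\<bar> * (1 / (1 + exp (\<alpha> * s - 2 * \<alpha> * \<sigma> n * r)))"
        unfolding f_def norm_mult fermi_of_real norm_of_real by (simp add: add_pos_pos less_imp_le)
      also have "\<dots> \<le> 1 / (1 + r\<^sup>2) * 1"
        by (intro mult_mono kbd) (auto simp: divide_le_eq add_pos_pos)
      finally show "norm (f n r) \<le> 1 / (1 + r\<^sup>2)" by simp
    qed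
    show "f n \<in> borel_measurable lborel" for n
      unfolding f_def k_def sinh_def by measurable
  qed measurable
  also have "(LINT r|lborel. complex_of_real (1 / (1 + r\<^sup>2)) * fermi (of_real (\<alpha> * s))) = of_real pi * fermi (of_real (\<alpha> * s))"
    using integrable_inverse_1_plus_square_UNIV by (simp add: integral_mult_left_zero integral_complex_of_real del: of_real_divide)
  finally have "(\<lambda>n. - 2 * \<i> * of_real \<alpha> * (LINT r|lborel. f n r)) \<longlonglongrightarrow> - 2 * \<i> * of_real \<alpha> * (of_real pi * fermi (of_real (\<alpha> * s)))"
    by (intro tendsto_intros)
  moreover have "- 2 * \<i> * of_real \<alpha> * (LINT r|lborel. f n r) =
      F_ext \<alpha> (of_real s + \<i> * of_real (\<theta> n)) - F_ext \<alpha> (of_real s - \<i> * of_real (\<theta> n))" for n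
    using fd_int_jump_kernel[OF \<alpha> \<theta>, of s n] \<theta>[of n] F_ext_eq_fd_int[OF \<alpha>]
    by (simp add: f_def k_def \<sigma>_def)
  moreover have "(\<lambda>n. F_ext \<alpha> (of_real s + \<i> * of_real (\<theta> n)) - F_ext \<alpha> (of_real s - \<i> * of_real (\<theta> n)))
     \<longlonglongrightarrow> F_ext \<alpha> (of_real s + \<i> * of_real pi) - F_ext \<alpha> (of_real s - \<i> * of_real pi)"
  proof -
    have "isCont (F_ext \<alpha>) z" if "\<bar>Im z\<bar> < pi + pi / \<alpha>" for z
      using holomorphic_on_imp_continuous_on[OF F_ext_holomorphic[OF \<alpha>]] that open_strip
      by (metis continuous_on_eq_continuous_at mem_Collect_eq strip_def)
    then show ?thesis using \<alpha>
      by (intro tendsto_diff isCont_tendsto_compose[of _ "F_ext \<alpha>"] tendsto_intros \<theta>lim) auto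
  qed
  ultimately show ?thesis using LIMSEQ_unique by (simp add: mult.assoc) blast
qed

lemma F_ext_jump:
  assumes \<alpha>: "\<alpha> > 0" and w: "\<bar>Im w\<bar> < pi / \<alpha>"
  shows "F_ext \<alpha> (w + \<i> * of_real pi) - F_ext \<alpha> (w - \<i> * of_real pi) =
    - 2 * \<i> * of_real \<alpha> * of_real pi * fermi (of_real \<alpha> * w)"
proof (rule strip_identity[of "\<lambda>w. F_ext \<alpha> (w + \<i> * of_real pi) - F_ext \<alpha> (w - \<i> * of_real pi)" "pi / \<alpha>"
     "\<lambda>w. - 2 * \<i> * of_real \<alpha> * of_real pi * fermi (of_real \<alpha> * w)" w])
  have shift: "(\<lambda>w. F_ext \<alpha> (w + c)) holomorphic_on strip (pi / \<alpha>)" if c: "\<bar>Im c\<bar> \<le> pi" for c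
  proof (intro holomorphic_on_F_ext \<alpha> holomorphic_intros)
    fix z assume "z \<in> strip (pi / \<alpha>)"
    then show "\<bar>Im (z + c)\<bar> < pi + pi / \<alpha>"
      using c abs_triangle_ineq[of "Im z" "Im c"] by (simp add: strip_def)
  qed
  show "(\<lambda>w. F_ext \<alpha> (w + \<i> * of_real pi) - F_ext \<alpha> (w - \<i> * of_real pi)) holomorphic_on strip (pi / \<alpha>)"
    using holomorphic_on_diff[OF shift[of "\<i> * of_real pi"] shift[of "- (\<i> * of_real pi)"]] by simp
  show "(\<lambda>w. - 2 * \<i> * of_real \<alpha> * of_real pi * fermi (of_real \<alpha> * w)) holomorphic_on strip (pi / \<alpha>)"
    using \<alpha> by (intro holomorphic_intros) (auto simp: strip_def abs_mult field_simps)
  show "F_ext \<alpha> (of_real s + \<i> * of_real pi) - F_ext \<alpha> (of_real s - \<i> * of_real pi) =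
     - 2 * \<i> * of_real \<alpha> * of_real pi * fermi (of_real \<alpha> * of_real s)" for s
    using F_ext_jump_of_real[OF \<alpha>, of s] by simp
qed (use w in \<open>auto simp: strip_def\<close>)

text \<open>
  The numbers \<open>u_k = - e^(y + (n - 2 k - 1) \<pi> i / n)\<close> are the \<open>n\<close>-th roots of \<open>- e^(n y)\<close>. Expanding
  \<open>1 / (1 - u_k)\<close> as a geometric sum of length \<open>n\<close> over \<open>1 - u_k^n\<close> and summing over \<open>k\<close> kills all powers
  except the zeroth.
\<close>
lemma fermi_multiplication:
  fixes y :: complex
  assumes n: "n > 0" and y: "Im y = 0"
  shows "(\<Sum>k = 0..n - 1. fermi (y + of_real ((real n - 2 * real k - 1) / real n) * of_real pi * \<i>)) =
    of_nat n * fermi (of_nat n * y)"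
proof -
  define c where "c = - exp (y + of_real ((real n - 1) / real n) * of_real pi * \<i>)"
  define \<omega> where "\<omega> = exp (- (2 * of_real pi * \<i> / of_nat n))"
  define u where "u k = c * \<omega> ^ k" for k
  have ue: "u k = - exp (y + of_real ((real n - 2 * real k - 1) / real n) * of_real pi * \<i>)" for k
  proof -
    have *: "\<omega> ^ k = exp (of_nat k * (- (2 * of_real pi * \<i> / of_nat n)))" by (simp only: \<omega>_def exp_of_nat_mult)
    have e: "y + of_real ((real n - 1) / real n) * of_real pi * \<i> + of_nat k * (- (2 * of_real pi * \<i> / of_nat n))
        = y + of_real ((real n - 2 * real k - 1) / real n) * of_real pi * \<i>"
      using n by (simp add: field_simps)
    show ?thesis unfolding u_def c_def * e[symmetric] exp_add by simp
  qed
  have \<omega>n: "\<omega> ^ n = 1"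
  proof -
    have "\<omega> ^ n = exp (of_nat n * (- (2 * of_real pi * \<i> / of_nat n)))" by (simp only: \<omega>_def exp_of_nat_mult)
    also have "of_nat n * (- (2 * of_real pi * \<i> / of_nat n)) = - (2 * of_real pi * \<i>)" using n by simp
    finally show ?thesis by (simp add: exp_minus)
  qed
  have cn: "c ^ n = - exp (of_nat n * y)"
  proof -
    have "c ^ n = (- 1) ^ n * exp (of_nat n * (y + of_real ((real n - 1) / real n) * of_real pi * \<i>))"
      unfolding c_def by (subst power_minus) (simp only: exp_of_nat_mult)
    also have "of_nat n * (y + of_real ((real n - 1) / real n) * of_real pi * \<i>) = of_nat n * y + of_nat (n - 1) * (of_real pi * \<i>)"
      using n by (simp add: field_simps of_nat_diff)
    also have "exp \<dots> = exp (of_nat n * y) * (- 1) ^ (n - 1)"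
      by (simp add: exp_add exp_of_nat_mult)
    finally show ?thesis using n by (cases n) auto
  qed
  have un: "u k ^ n = - exp (of_nat n * y)" for k
  proof -
    have "u k ^ n = c ^ n * (\<omega> ^ n) ^ k" by (simp add: u_def power_mult_distrib power_mult[symmetric] mult.commute)
    then show ?thesis by (simp add: cn \<omega>n)
  qed
  have y1: "1 + exp (of_nat n * y) \<noteq> 0" using y by (intro one_plus_exp_neq_0) simp
  have f: "fermi (y + of_real ((real n - 2 * real k - 1) / real n) * of_real pi * \<i>) = (\<Sum>j<n. u k ^ j) / (1 + exp (of_nat n * y))" for k
  proof -
    have *: "(1 - u k) * (\<Sum>j<n. u k ^ j) = 1 + exp (of_nat n * y)"
      using one_diff_power_eq[of "u k" n] un[of k] by simp
    then have "1 - u k \<noteq> 0" using y1 by auto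
    with * have "1 / (1 - u k) = (\<Sum>j<n. u k ^ j) / (1 + exp (of_nat n * y))"
      using y1 by (simp add: field_simps)
    then show ?thesis by (simp add: fermi_def ue)
  qed
  have geo: "(\<Sum>k<n. u k ^ j) = (if j = 0 then of_nat n else 0)" if j: "j < n" for j
  proof (cases "j = 0")
    case False
    have "\<omega> ^ j \<noteq> 1"
    proof
      assume "\<omega> ^ j = 1"
      then have "exp (of_nat j * (- (2 * of_real pi * \<i> / of_nat n))) = 1" by (simp only: \<omega>_def exp_of_nat_mult)
      then obtain m :: int where "Im (of_nat j * (- (2 * of_real pi * \<i> / of_nat n))) = of_int (2 * m) * pi"
        unfolding exp_eq_1 by blast
      moreover have "Im (of_nat j * (- (2 * of_real pi * \<i> / of_nat n))) = - (real j / real n) * (2 * pi)"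
        by simp
      ultimately have "- (real j / real n) * (2 * pi) = of_int m * (2 * pi)" by simp
      then have "- (real j / real n) = of_int m"
        using mult_right_cancel[of "2 * pi" "- (real j / real n)" "of_int m"] by simp
      then have "\<bar>real_of_int m\<bar> = real j / real n" by (metis abs_minus_cancel abs_of_nonneg divide_nonneg_nonneg of_nat_0_le_iff)
      then have "0 < real_of_int \<bar>m\<bar>" "real_of_int \<bar>m\<bar> < 1" using j False by simp_all
      then show False unfolding of_int_0_less_iff of_int_less_1_iff by linarith
    qed
    have "(\<Sum>k<n. u k ^ j) = c ^ j * (\<Sum>k<n. (\<omega> ^ j) ^ k)"
      unfolding u_def by (simp add: power_mult_distrib sum_distrib_left power_mult[symmetric] mult.commute)
    also have "(\<Sum>k<n. (\<omega> ^ j) ^ k) = 0"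
    proof -
      have "(1 - \<omega> ^ j) * (\<Sum>k<n. (\<omega> ^ j) ^ k) = 1 - (\<omega> ^ j) ^ n" by (rule one_diff_power_eq[symmetric])
      also have "(\<omega> ^ j) ^ n = (\<omega> ^ n) ^ j" by (simp add: power_mult[symmetric] mult.commute)
      finally show ?thesis using \<open>\<omega> ^ j \<noteq> 1\<close> by (simp add: \<omega>n)
    qed
    finally show ?thesis using False by simp
  qed simp
  have "{0..n - 1} = {..<n}" using n by auto
  then have "(\<Sum>k = 0..n - 1. fermi (y + of_real ((real n - 2 * real k - 1) / real n) * of_real pi * \<i>)) =
      (\<Sum>k<n. \<Sum>j<n. u k ^ j) / (1 + exp (of_nat n * y))"
    unfolding f by (simp add: sum_divide_distrib)
  also have "(\<Sum>k<n. \<Sum>j<n. u k ^ j) = (\<Sum>j<n. \<Sum>k<n. u k ^ j)" by (rule sum.swap)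
  also have "\<dots> = (\<Sum>j<n. if j = 0 then of_nat n else 0)" by (intro sum.cong geo) auto
  also have "\<dots> = of_nat n" using n by (simp add: sum.delta)
  finally show ?thesis by (simp add: fermi_def)
qed

lemma abs_centred_index_le:
  assumes "k < n"
  shows "\<bar>real n - 2 * real k - 1\<bar> \<le> real n - 1"
  using assms by (auto simp: abs_le_iff)

text \<open>
  On the real axis all the shifted arguments lie in the strip \<open>|Im v| < n \<pi>/\<alpha>\<close> of the dual form for
  \<open>\<alpha>/n\<close>. There only the second Fermi factor depends on the argument, so the sum can be
  carried out under the integral.
\<close>
lemma F_ext_multiplication:
  assumes \<alpha>: "\<alpha> > 0" and n: "n > 0" and w: "\<bar>Im w\<bar> < pi + pi / \<alpha>"
  shows "F_ext \<alpha> w = (\<Sum>k = 0..n - 1. F_ext (\<alpha> / real n) (w + of_real ((real n - 2 * real k - 1) / \<alpha>) * of_real pi * \<i>))"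
proof (rule strip_identity[of "F_ext \<alpha>" "pi + pi / \<alpha>"
    "\<lambda>w. (\<Sum>k = 0..n - 1. F_ext (\<alpha> / real n) (w + of_real ((real n - 2 * real k - 1) / \<alpha>) * of_real pi * \<i>))" w])
  have an: "\<alpha> / real n > 0" using \<alpha> n by simp
  have kb: "\<bar>(real n - 2 * real k - 1) / \<alpha> * pi\<bar> \<le> (real n - 1) * pi / \<alpha>" if k: "k \<in> {0..n-1}" for k
  proof -
    have "\<bar>real n - 2 * real k - 1\<bar> \<le> real n - 1" using k n by (intro abs_centred_index_le) auto
    then have "\<bar>real n - 2 * real k - 1\<bar> * (pi / \<alpha>) \<le> (real n - 1) * (pi / \<alpha>)" using \<alpha> by (intro mult_right_mono) auto
    then show ?thesis using \<alpha> by (simp add: abs_mult)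
  qed
  show "F_ext \<alpha> holomorphic_on strip (pi + pi / \<alpha>)" by (rule F_ext_holomorphic[OF \<alpha>])
  show "(\<lambda>w. \<Sum>k = 0..n - 1. F_ext (\<alpha> / real n) (w + of_real ((real n - 2 * real k - 1) / \<alpha>) * of_real pi * \<i>)) holomorphic_on strip (pi + pi / \<alpha>)"
  proof (rule holomorphic_on_sum)
    fix k assume k: "k \<in> {0..n-1}"
    have eq: "pi + pi / (\<alpha> / real n) = (pi + pi / \<alpha>) + (real n - 1) * pi / \<alpha>" using \<alpha> by (simp add: field_simps)
    show "(\<lambda>w. F_ext (\<alpha> / real n) (w + of_real ((real n - 2 * real k - 1) / \<alpha>) * of_real pi * \<i>)) holomorphic_on strip (pi + pi / \<alpha>)"
    proof (intro holomorphic_intros holomorphic_on_F_ext an)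
      fix z assume "z \<in> strip (pi + pi / \<alpha>)"
      then show "\<bar>Im (z + of_real ((real n - 2 * real k - 1) / \<alpha>) * of_real pi * \<i>)\<bar> < pi + pi / (\<alpha> / real n)"
        using kb[OF k] abs_triangle_ineq[of "Im z" "(real n - 2 * real k - 1) / \<alpha> * pi"]
        unfolding eq strip_def by simp
    qed
  qed
  fix s :: real
  define v where "v k = of_real s + of_real ((real n - 2 * real k - 1) / \<alpha>) * of_real pi * \<i>" for k
  have v: "\<bar>Im (v k)\<bar> < pi / (\<alpha> / real n)" if "k \<in> {0..n-1}" for k
  proof -
    have "(real n - 1) * pi / \<alpha> < real n * pi / \<alpha>" using \<alpha> by (intro divide_strict_right_mono) auto
    then show ?thesis using kb[OF that] \<alpha> by (simp add: v_def mult.commute)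
  qed
  define y where "y x = complex_of_real (\<alpha> / real n * s + x)" for x
  have yv: "of_real (\<alpha> / real n) * v k + of_real x = y x + of_real ((real n - 2 * real k - 1) / real n) * of_real pi * \<i>" for k x
    using \<alpha> n by (simp add: v_def y_def field_simps)
  have sum_eq: "(\<Sum>k = 0..n - 1. fermi (y x + of_real ((real n - 2 * real k - 1) / real n) * of_real pi * \<i>)) =
      of_nat n * fermi (of_nat n * y x)" for x
    by (rule fermi_multiplication[OF n]) (simp add: y_def)
  have int: "integrable lborel (\<lambda>x. fermi (- of_real (x / (\<alpha> / real n))) * fermi (of_real (\<alpha> / real n) * v k + of_real x))" if "k \<in> {0..n-1}" for k
  proof -
    have "\<alpha> / real n * \<bar>Im (v k)\<bar> < pi" using v[OF that] \<alpha> n by (simp add: field_simps)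
    then show ?thesis using fd_integrable[OF an, of 0 "\<alpha> / real n" "v k"] an by simp
  qed
  have "(\<Sum>k = 0..n - 1. F_ext (\<alpha> / real n) (v k)) = (\<Sum>k = 0..n - 1. fd_int (\<alpha> / real n) 0 (\<alpha> / real n) (v k))"
    by (intro sum.cong F_ext_eq_dual an v) auto
  also have "\<dots> = (LINT x|lborel. (\<Sum>k = 0..n - 1. fermi (- of_real (x / (\<alpha> / real n))) * fermi (of_real (\<alpha> / real n) * v k + of_real x)))"
    using int by (subst Bochner_Integration.integral_sum) (auto simp: fd_int_def)
  also have "\<dots> = (LINT x|lborel. of_nat n * (fermi (- of_real (x / (\<alpha> / real n))) * fermi (of_nat n * y x)))"
    unfolding yv sum_distrib_left[symmetric] sum_eq by (simp only: mult.left_commute)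
  also have "\<dots> = of_nat n * (LINT x|lborel. fermi (- of_real (x / (\<alpha> / real n))) * fermi (of_nat n * y x))"
    by simp
  also have "(LINT x|lborel. fermi (- of_real (x / (\<alpha> / real n))) * fermi (of_nat n * y x)) = of_real (1 / real n) * fd_int \<alpha> 0 \<alpha> (of_real s)"
    using n \<alpha> by (subst lborel_integral_real_affine[of "1 / real n" _ 0]) (auto simp: fd_int_def y_def scaleR_conv_of_real algebra_simps)
  also have "of_nat n * (of_real (1 / real n) * fd_int \<alpha> 0 \<alpha> (of_real s)) = fd_int \<alpha> 0 \<alpha> (of_real s)" using n by simp
  also have "\<dots> = F_ext \<alpha> (of_real s)" using F_ext_eq_dual[OF \<alpha>, of "of_real s"] \<alpha> by simp
  finally show "F_ext \<alpha> (of_real s) = (\<Sum>k = 0..n - 1. F_ext (\<alpha> / real n) (of_real s + of_real ((real n - 2 * real k - 1) / \<alpha>) * of_real pi * \<i>))"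
    by (simp add: v_def)
qed (use w in \<open>auto simp: strip_def\<close>)

section \<open>The logarithm of \<open>\<phi>\<close>\<close>

text \<open>
  The derivative of \<open>ln \<phi>(e^t)\<close>, continued from the real line through \<open>F_ext\<close>.
\<close>
definition phi_log_deriv :: "real \<Rightarrow> real \<Rightarrow> complex \<Rightarrow> complex" where
  "phi_log_deriv \<alpha> \<rho> t =
     (F_ext \<alpha> (\<i> * of_real (pi * \<rho>) - t) - F_ext \<alpha> (- \<i> * of_real (pi * \<rho>) - t)) / (2 * of_real pi * \<i>)"

text \<open>
  The half-width of the strip in which both \<open>\<plusminus>\<pi> i \<rho> - t\<close> stay in the domain of \<open>F_ext\<close>.
\<close>
definition phi_width :: "real \<Rightarrow> real \<Rightarrow> real" where
  "phi_width \<alpha> \<rho> = pi * (1 - \<rho>) + pi / \<alpha>"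

lemma phi_width_gt:
  assumes "\<alpha> > 0" "0 < \<rho>" "\<rho> < 1"
  shows "phi_width \<alpha> \<rho> > 0"
  using assms by (auto simp: phi_width_def intro!: add_pos_pos)

lemma Im_shift_bounds:
  assumes "0 < \<rho>" "\<bar>Im t\<bar> < phi_width \<alpha> \<rho>"
  shows "\<bar>Im (\<i> * of_real (pi * \<rho>) - t)\<bar> < pi + pi / \<alpha>" "\<bar>Im (- \<i> * of_real (pi * \<rho>) - t)\<bar> < pi + pi / \<alpha>"
proof -
  have "\<bar>pi * \<rho>\<bar> = pi * \<rho>" using assms by (simp add: abs_mult)
  moreover have "pi * \<rho> + \<bar>Im t\<bar> < pi + pi / \<alpha>" using assms by (simp add: phi_width_def algebra_simps)
  ultimately show "\<bar>Im (\<i> * of_real (pi * \<rho>) - t)\<bar> < pi + pi / \<alpha>" "\<bar>Im (- \<i> * of_real (pi * \<rho>) - t)\<bar> < pi + pi / \<alpha>"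
    by simp_all
qed

lemma phi_log_deriv_holomorphic:
  assumes "\<alpha> > 0" "0 < \<rho>"
  shows "phi_log_deriv \<alpha> \<rho> holomorphic_on strip (phi_width \<alpha> \<rho>)"
  unfolding phi_log_deriv_def
  by (intro holomorphic_intros holomorphic_on_F_ext assms Im_shift_bounds) (auto simp: strip_def)

text \<open>
  The exponential decay at \<open>-\<infinity>\<close> is what makes the integral from \<open>0\<close> in the definition of \<open>phi_pos\<close>
  converge, and what gives \<open>log_phi\<close> the limit \<open>0\<close> along every horizontal line.
\<close>
lemma phi_log_deriv_bound:
  assumes "\<alpha> > 0" "0 < \<rho>" "b < phi_width \<alpha> \<rho>"
  shows "\<exists>C>0. \<forall>t. \<bar>Im t\<bar> \<le> b \<longrightarrow> norm (phi_log_deriv \<alpha> \<rho> t) \<le> C * exp (\<alpha> / (\<alpha> + 1) * Re t)"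
proof -
  have "pi * \<rho> + b < pi + pi / \<alpha>" using assms by (simp add: phi_width_def algebra_simps)
  from F_ext_bound[OF assms(1) this] obtain C where C: "C > 0"
    "\<And>w. \<bar>Im w\<bar> \<le> pi * \<rho> + b \<Longrightarrow> norm (F_ext \<alpha> w) \<le> C * exp (- (\<alpha> / (\<alpha> + 1)) * Re w)" by blast
  show ?thesis
  proof (intro exI[of _ "C / pi"] conjI allI impI)
    fix t assume t: "\<bar>Im t\<bar> \<le> b"
    have pr: "\<bar>pi * \<rho>\<bar> = pi * \<rho>" using assms by (simp add: abs_mult)
    have "\<bar>Im (\<i> * of_real (pi * \<rho>) - t)\<bar> \<le> pi * \<rho> + b" "\<bar>Im (- \<i> * of_real (pi * \<rho>) - t)\<bar> \<le> pi * \<rho> + b"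
      using t pr by simp_all
    from this[THEN C(2)]
    have "norm (F_ext \<alpha> (\<i> * of_real (pi * \<rho>) - t)) \<le> C * exp (\<alpha> / (\<alpha> + 1) * Re t)"
      "norm (F_ext \<alpha> (- \<i> * of_real (pi * \<rho>) - t)) \<le> C * exp (\<alpha> / (\<alpha> + 1) * Re t)" by simp_all
    then have "norm (F_ext \<alpha> (\<i> * of_real (pi * \<rho>) - t) - F_ext \<alpha> (- \<i> * of_real (pi * \<rho>) - t)) \<le>
        2 * (C * exp (\<alpha> / (\<alpha> + 1) * Re t))"
      by (intro order_trans[OF norm_triangle_ineq4]) linarith
    then show "norm (phi_log_deriv \<alpha> \<rho> t) \<le> C / pi * exp (\<alpha> / (\<alpha> + 1) * Re t)"
      by (simp add: phi_log_deriv_def norm_divide norm_mult field_simps)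
  qed (use C in auto)
qed

lemma set_integral_powr_from_0:
  fixes c z :: real
  assumes c: "c > 0" and z: "z > 0"
  shows "set_integrable lborel {0<..<z} (\<lambda>u. u powr (c - 1))"
    and "(LINT u:{0<..<z}|lborel. u powr (c - 1)) = z powr c / c"
proof -
  have hi: "((\<lambda>u. u powr (c - 1)) has_integral z powr c / c) {0<..<z}"
    using has_integral_powr_from_0[of "c - 1" z] c z by (simp add: has_integral_Icc_iff_Ioo)
  then have "(\<lambda>u. u powr (c - 1)) absolutely_integrable_on {0<..<z}"
    by (intro nonnegative_absolutely_integrable_1) (auto simp: has_integral_iff)
  then have "integrable lebesgue (\<lambda>u. indicator {0<..<z} u *\<^sub>R u powr (c - 1))"
    unfolding set_integrable_def .
  then show int: "set_integrable lborel {0<..<z} (\<lambda>u. u powr (c - 1))"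
    unfolding set_integrable_def by (subst (asm) integrable_completion) auto
  show "(LINT u:{0<..<z}|lborel. u powr (c - 1)) = z powr c / c"
    using set_borel_integral_eq_integral(2)[OF int] hi by (simp add: has_integral_iff)
qed

text \<open>
  A primitive exists because the strip is convex. On the real line it differs by a constant from the
  integral over \<open>(0, e^s)\<close>, which tends to \<open>0\<close> with its upper limit since the integrand is \<open>O(u^(c-1))\<close> for
  some \<open>c > 0\<close>.
\<close>
lemma exists_log_phi:
  fixes \<alpha> \<rho> :: real
  assumes \<alpha>: "\<alpha> > 0" and \<rho>: "0 < \<rho>" "\<rho> < 1"
  shows "\<exists>H. (\<forall>t. \<bar>Im t\<bar> < phi_width \<alpha> \<rho> \<longrightarrow> (H has_field_derivative phi_log_deriv \<alpha> \<rho> t) (at t)) \<and>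
    (\<forall>s::real. phi_pos \<alpha> \<rho> (exp s) = exp (H (of_real s))) \<and>
    ((\<lambda>s::real. H (of_real s)) \<longlongrightarrow> 0) at_bot"
proof -
  define L where "L = phi_log_deriv \<alpha> \<rho>"
  define W where "W = phi_width \<alpha> \<rho>"
  have W: "W > 0" unfolding W_def by (rule phi_width_gt[OF assms])
  define c where "c = \<alpha> / (\<alpha> + 1)"
  have c: "c > 0" using \<alpha> by (simp add: c_def)
  have "\<exists>G. \<forall>t\<in>strip W. (G has_field_derivative L t) (at t within strip W)"
    unfolding L_def W_def
  proof (rule holomorphic_convex_primitive'[OF convex_strip open_strip phi_log_deriv_holomorphic[OF \<alpha> \<rho>(1)]])
    fix g assume g: "\<And>t. t \<in> strip (phi_width \<alpha> \<rho>) \<Longrightarrow> (g has_field_derivative phi_log_deriv \<alpha> \<rho> t) (at t within strip (phi_width \<alpha> \<rho>))"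
    show "\<exists>G. \<forall>t\<in>strip (phi_width \<alpha> \<rho>). (G has_field_derivative phi_log_deriv \<alpha> \<rho> t) (at t within strip (phi_width \<alpha> \<rho>))"
      by (intro exI[of _ g] ballI g)
  qed
  then obtain G where G: "\<forall>t\<in>strip W. (G has_field_derivative L t) (at t within strip W)" ..
  have G': "(G has_field_derivative L t) (at t)" if "\<bar>Im t\<bar> < W" for t
  proof -
    have "t \<in> strip W" using that by (simp add: strip_def)
    then show ?thesis using bspec[OF G, of t] at_within_open[OF _ open_strip, of t W] by simp
  qed
  from phi_log_deriv_bound[OF \<alpha> \<rho>(1) W[unfolded W_def]]
  obtain C where C: "C > 0" "\<forall>t. \<bar>Im t\<bar> \<le> 0 \<longrightarrow> norm (L t) \<le> C * exp (c * Re t)"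
    unfolding L_def c_def by blast
  define f where "f u = 1 / (2 * of_real pi * \<i> * of_real u) *
            (F_int \<alpha> (of_real pi * \<i> * of_real \<rho> - of_real (ln u))
             - F_int \<alpha> (- of_real pi * \<i> * of_real \<rho> - of_real (ln u)))" for u :: real
  have fL: "f u = L (of_real (ln u)) / of_real u" for u
  proof -
    have "pi * \<rho> < pi * 1" using \<rho> by (intro mult_strict_left_mono) auto
    moreover have "0 < pi * \<rho>" using \<rho> by simp
    ultimately have im: "\<bar>Im (\<i> * of_real (pi * \<rho>) - of_real (ln u))\<bar> < pi" "\<bar>Im (- \<i> * of_real (pi * \<rho>) - of_real (ln u))\<bar> < pi"
      by simp_all
    have e: "of_real pi * \<i> * of_real \<rho> = \<i> * complex_of_real (pi * \<rho>)" "- of_real pi * \<i> * of_real \<rho> = - \<i> * complex_of_real (pi * \<rho>)"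
      by simp_all
    have "1 / (2 * of_real pi * \<i> * of_real u) * (A - B) = (A - B) / (2 * of_real pi * \<i>) / of_real u" for A B :: complex
      by simp
    then show ?thesis
      unfolding f_def L_def phi_log_deriv_def e F_ext_eq_F_int[OF \<alpha> im(1)] F_ext_eq_F_int[OF \<alpha> im(2)] .
  qed
  have fcont: "continuous_on {0<..} f"
  proof -
    have "continuous_on (strip W) L"
      unfolding L_def W_def by (intro holomorphic_on_imp_continuous_on phi_log_deriv_holomorphic \<alpha> \<rho>)
    then have "continuous_on {0<..} (\<lambda>u. L (of_real (ln u)))"
      by (rule continuous_on_compose2) (use W in \<open>auto intro!: continuous_intros simp: strip_def\<close>)
    then show ?thesis unfolding fL by (intro continuous_intros) auto
  qed
  have fbd: "norm (f u) \<le> C * u powr (c - 1)" if "u > 0" for u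
  proof -
    have "norm (L (of_real (ln u))) \<le> C * exp (c * ln u)" using C(2)[rule_format, of "of_real (ln u)"] by simp
    then have "norm (f u) \<le> C * exp (c * ln u) / u"
      using that by (simp add: fL norm_divide divide_right_mono)
    also have "\<dots> = C * u powr (c - 1)" using that by (simp add: powr_def exp_diff left_diff_distrib)
    finally show ?thesis .
  qed
  have fint: "set_integrable lborel {0<..<z} f" if z: "z > 0" for z
  proof (rule set_integrable_bound)
    show "set_integrable lborel {0<..<z} (\<lambda>u. C * u powr (c - 1))"
      using set_integral_powr_from_0(1)[OF c z] by simp
    show "set_borel_measurable lborel {0<..<z} f"
    proof -
      have "continuous_on {0<..<z} f" by (rule continuous_on_subset[OF fcont]) auto
      then show ?thesis
        using borel_measurable_continuous_on_indicator[of "{0<..<z}" f] by (simp add: set_borel_measurable_def)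
    qed
    show "AE x in lborel. x \<in> {0<..<z} \<longrightarrow> norm (f x) \<le> norm (C * x powr (c - 1))"
      using fbd C(1) by (auto intro!: AE_I2)
  qed
  define h where "h z = (LINT u:{0<..<z}|lborel. f u)" for z
  have hbd: "norm (h z) \<le> C * (z powr c / c)" if z: "z > 0" for z
  proof -
    have "norm (h z) \<le> (LINT u:{0<..<z}|lborel. norm (f u))"
      unfolding h_def by (rule set_integral_norm_bound[OF fint[OF z]])
    also have "\<dots> \<le> (LINT u:{0<..<z}|lborel. C * u powr (c - 1))"
      using set_integral_powr_from_0(1)[OF c z]
      by (intro set_integral_mono set_integrable_norm fint z) (auto intro: fbd)
    also have "\<dots> = C * (z powr c / c)" using set_integral_powr_from_0(2)[OF c z] by simp
    finally show ?thesis .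
  qed
  have hdiff: "h z' - h z = G (of_real (ln z')) - G (of_real (ln z))" if z: "0 < z" "z \<le> z'" for z z'
  proof -
    have hI: "h x = integral {0..x} f" and fI: "f integrable_on {0..x}" if "x > 0" for x
      using set_borel_integral_eq_integral[OF fint[OF that]]
      by (simp_all add: h_def integral_open_interval_real integrable_on_Icc_iff_Ioo)
    have "h z' = h z + integral {z..z'} f"
      using Henstock_Kurzweil_Integration.integral_combine[of 0 z z' f] fI[of z'] z by (simp add: hI)
    moreover have "integral {z..z'} f = G (of_real (ln z')) - G (of_real (ln z))"
    proof (rule integral_unique)
      show "(f has_integral G (of_real (ln z')) - G (of_real (ln z))) {z..z'}"
      proof (rule fundamental_theorem_of_calculus[OF z(2)])
      fix u assume u: "u \<in> {z..z'}"
      have "((\<lambda>u. of_real (ln u)) has_vector_derivative complex_of_real (1 / u)) (at u within {z..z'})"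
        using u z by (intro has_vector_derivative_of_real) (auto intro!: derivative_eq_intros simp: has_real_derivative_iff_has_vector_derivative[symmetric])
      from field_vector_diff_chain_within[OF this, of G "L (of_real (ln u))"]
      show "((\<lambda>u. G (of_real (ln u))) has_vector_derivative f u) (at u within {z..z'})"
        using G'[of "of_real (ln u)"] W by (auto simp: fL o_def has_field_derivative_at_within)
      qed
    qed
    ultimately show ?thesis by simp
  qed
  define K where "K = h 1 - G 0"
  have hG: "h z = G (of_real (ln z)) + K" if "z > 0" for z
    using hdiff[of 1 z] hdiff[of z 1] that by (cases "z \<ge> 1") (auto simp: K_def algebra_simps)
  define H where "H t = G t + K" for t
  have Hh: "H (of_real s) = h (exp s)" for s using hG[of "exp s"] by (simp add: H_def)
  show ?thesis
  proof (intro exI[of _ H] conjI allI impI)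
    show "(H has_field_derivative phi_log_deriv \<alpha> \<rho> t) (at t)" if "\<bar>Im t\<bar> < phi_width \<alpha> \<rho>" for t
      using G'[of t] that unfolding H_def L_def W_def by (auto intro!: derivative_eq_intros)
    show "phi_pos \<alpha> \<rho> (exp s) = exp (H (of_real s))" for s
      by (simp add: phi_pos_def Hh h_def f_def)
    show "((\<lambda>s. H (of_real s)) \<longlongrightarrow> 0) at_bot"
    proof (rule Lim_null_comparison)
      show "\<forall>\<^sub>F s in at_bot. norm (H (of_real s)) \<le> C * (exp s powr c / c)"
        using hbd by (simp add: Hh)
      have "((\<lambda>s. C * (exp (c * s) / c)) \<longlongrightarrow> 0) at_bot" using c by real_asymp
      then show "((\<lambda>s. C * (exp s powr c / c)) \<longlongrightarrow> 0) at_bot" by (simp add: powr_def)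
    qed
  qed
qed

text \<open>
  The limit at \<open>-\<infinity>\<close> selects one primitive, so that the choice is determined throughout the strip.
\<close>
definition log_phi :: "real \<Rightarrow> real \<Rightarrow> complex \<Rightarrow> complex" where
  "log_phi \<alpha> \<rho> = (SOME H.
     (\<forall>t. \<bar>Im t\<bar> < phi_width \<alpha> \<rho> \<longrightarrow> (H has_field_derivative phi_log_deriv \<alpha> \<rho> t) (at t)) \<and>
     (\<forall>s::real. phi_pos \<alpha> \<rho> (exp s) = exp (H (of_real s))) \<and>
     ((\<lambda>s::real. H (of_real s)) \<longlongrightarrow> 0) at_bot)"

context
  fixes \<alpha> \<rho> :: real
  assumes \<alpha>: "\<alpha> > 0" and \<rho>: "0 < \<rho>" "\<rho> < 1"
begin

lemma log_phi_has_field_derivative: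
    "\<bar>Im t\<bar> < phi_width \<alpha> \<rho> \<Longrightarrow> (log_phi \<alpha> \<rho> has_field_derivative phi_log_deriv \<alpha> \<rho> t) (at t)"
  and phi_pos_exp: "phi_pos \<alpha> \<rho> (exp s) = exp (log_phi \<alpha> \<rho> (of_real s))"
  and log_phi_tendsto_0_real: "((\<lambda>s::real. log_phi \<alpha> \<rho> (of_real s)) \<longlongrightarrow> 0) at_bot"
  using someI_ex[OF exists_log_phi[OF \<alpha> \<rho>]] unfolding log_phi_def[symmetric] by blast+

lemma log_phi_analytic: "log_phi \<alpha> \<rho> analytic_on strip (phi_width \<alpha> \<rho>)"
  using log_phi_has_field_derivative open_strip
  by (subst analytic_on_open) (auto simp: strip_def holomorphic_on_open)

lemma log_phi_tendsto_0:
  assumes y: "\<bar>y\<bar> < phi_width \<alpha> \<rho>"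
  shows "((\<lambda>s::real. log_phi \<alpha> \<rho> (of_real s + \<i> * of_real y)) \<longlongrightarrow> 0) at_bot"
proof -
  define c where "c = \<alpha> / (\<alpha> + 1)"
  have c: "c > 0" using \<alpha> by (simp add: c_def)
  obtain C where C: "C > 0" "\<And>t. \<bar>Im t\<bar> \<le> \<bar>y\<bar> \<Longrightarrow> norm (phi_log_deriv \<alpha> \<rho> t) \<le> C * exp (c * Re t)"
    using phi_log_deriv_bound[OF \<alpha> \<rho>(1) y] unfolding c_def by blast
  have bd: "norm (log_phi \<alpha> \<rho> (of_real s + \<i> * of_real y) - log_phi \<alpha> \<rho> (of_real s)) \<le> C * exp (c * s) * \<bar>y\<bar>" for s :: real
  proof -
    define S where "S = {t. Re t \<le> s} \<inter> {t. Re t \<ge> s} \<inter> {t. Im t \<le> \<bar>y\<bar>} \<inter> {t. Im t \<ge> - \<bar>y\<bar>}"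
    have "convex S" unfolding S_def
      by (intro convex_Int convex_halfspace_Im_le convex_halfspace_Im_ge convex_halfspace_Re_le convex_halfspace_Re_ge)
    then have "norm (log_phi \<alpha> \<rho> (of_real s + \<i> * of_real y) - log_phi \<alpha> \<rho> (of_real s)) \<le>
        C * exp (c * s) * norm (of_real s + \<i> * of_real y - complex_of_real s)"
    proof (rule field_differentiable_bound)
      fix t assume t: "t \<in> S"
      show "(log_phi \<alpha> \<rho> has_field_derivative phi_log_deriv \<alpha> \<rho> t) (at t within S)"
        using t y by (intro has_field_derivative_at_within[OF log_phi_has_field_derivative]) (auto simp: S_def)
      have "Re t = s" "\<bar>Im t\<bar> \<le> \<bar>y\<bar>" using t by (auto simp: S_def)
      then show "norm (phi_log_deriv \<alpha> \<rho> t) \<le> C * exp (c * s)" using C(2)[of t] by simp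
    qed (auto simp: S_def)
    then show ?thesis by (simp add: norm_mult)
  qed
  have "((\<lambda>s::real. log_phi \<alpha> \<rho> (of_real s + \<i> * of_real y) - log_phi \<alpha> \<rho> (of_real s)) \<longlongrightarrow> 0) at_bot"
  proof (rule Lim_null_comparison)
    show "((\<lambda>s. C * exp (c * s) * \<bar>y\<bar>) \<longlongrightarrow> 0) at_bot" using c by real_asymp
  qed (use bd in simp)
  from tendsto_add[OF this log_phi_tendsto_0_real] show ?thesis by simp
qed

lemma log_phi_neg:
  assumes t: "\<bar>Im t\<bar> < phi_width \<alpha> \<rho>"
  shows "log_phi \<alpha> \<rho> (- t) = log_phi \<alpha> \<rho> t + of_real (\<alpha> * \<rho>) * t"
proof -
  define D where "D t = log_phi \<alpha> \<rho> (- t) - log_phi \<alpha> \<rho> t - of_real (\<alpha> * \<rho>) * t" for t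
  have W: "phi_width \<alpha> \<rho> > 0" by (rule phi_width_gt[OF \<alpha> \<rho>])
  have "(D has_field_derivative 0) (at z)" if z: "z \<in> strip (phi_width \<alpha> \<rho>)" for z
  proof -
    have z': "\<bar>Im z\<bar> < phi_width \<alpha> \<rho>" "\<bar>Im (- z)\<bar> < phi_width \<alpha> \<rho>" using z by (auto simp: strip_def)
    have "((\<lambda>t. log_phi \<alpha> \<rho> (- t)) has_field_derivative phi_log_deriv \<alpha> \<rho> (- z) * (- 1)) (at z)"
      by (rule DERIV_chain2[of _ _ uminus, OF log_phi_has_field_derivative[OF z'(2)]]) (auto intro!: derivative_eq_intros)
    then have "(D has_field_derivative (phi_log_deriv \<alpha> \<rho> (- z) * (- 1) - phi_log_deriv \<alpha> \<rho> z - of_real (\<alpha> * \<rho>))) (at z)"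
      unfolding D_def by (auto intro!: derivative_eq_intros log_phi_has_field_derivative z')
    also have "phi_log_deriv \<alpha> \<rho> (- z) * (- 1) - phi_log_deriv \<alpha> \<rho> z - of_real (\<alpha> * \<rho>) = 0"
    proof -
      have e1: "F_ext \<alpha> (\<i> * of_real (pi * \<rho>) - - z) = F_ext \<alpha> (- \<i> * of_real (pi * \<rho>) - z) + of_real \<alpha> * (- \<i> * of_real (pi * \<rho>) - z)"
        using F_ext_reflection[OF \<alpha> Im_shift_bounds(2)[OF \<rho>(1) z'(1)]] by (simp add: add.commute)
      have e2: "F_ext \<alpha> (- \<i> * of_real (pi * \<rho>) - - z) = F_ext \<alpha> (\<i> * of_real (pi * \<rho>) - z) + of_real \<alpha> * (\<i> * of_real (pi * \<rho>) - z)"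
        using F_ext_reflection[OF \<alpha> Im_shift_bounds(1)[OF \<rho>(1) z'(1)]] by simp
      show ?thesis unfolding phi_log_deriv_def e1 e2 by (simp add: field_simps)
    qed
    finally show ?thesis .
  qed
  from has_field_derivative_zero_constant[OF convex_strip has_field_derivative_at_within[OF this]]
  obtain k where k: "\<And>z. z \<in> strip (phi_width \<alpha> \<rho>) \<Longrightarrow> D z = k" by blast
  have "D t = D 0" using k[of t] k[of 0] t W by (auto simp: strip_def)
  then show ?thesis by (simp add: D_def algebra_simps)
qed

end

text \<open>
  The comparison principle for logarithms of \<open>\<phi>\<close>: it turns identities between derivatives into
  identities between functions, the common limit at \<open>-\<infinity>\<close> fixing the constant.
\<close>
lemma strip_primitive_unique:
  fixes f g :: "complex \<Rightarrow> complex"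
  assumes f: "\<And>t. \<bar>Im t\<bar> < B \<Longrightarrow> (f has_field_derivative d t) (at t)"
    and g: "\<And>t. \<bar>Im t\<bar> < B \<Longrightarrow> (g has_field_derivative d t) (at t)"
    and f0: "((\<lambda>s::real. f (of_real s)) \<longlongrightarrow> l) at_bot" and g0: "((\<lambda>s::real. g (of_real s)) \<longlongrightarrow> l) at_bot"
    and t: "\<bar>Im t\<bar> < B"
  shows "f t = g t"
proof -
  have "((\<lambda>t. f t - g t) has_field_derivative 0) (at z within strip B)" if "z \<in> strip B" for z
    using DERIV_diff[OF f g, of z] that by (simp add: strip_def has_field_derivative_at_within)
  from has_field_derivative_zero_constant[OF convex_strip this]
  obtain k where k: "\<And>z. z \<in> strip B \<Longrightarrow> f z - g z = k" by blast
  have "f (of_real s) - g (of_real s) = k" for s :: real using k t by (auto simp: strip_def)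
  with tendsto_diff[OF f0 g0] have "((\<lambda>s::real. k) \<longlongrightarrow> 0) at_bot" by simp
  then have "k = 0" by (simp add: tendsto_const_iff)
  then show ?thesis using k[of t] t by (auto simp: strip_def)
qed

lemma log_phi_duality:
  assumes \<alpha>: "\<alpha> > 0" and \<rho>: "0 < \<rho>" "\<rho> < 1" and \<alpha>\<rho>: "\<alpha> * \<rho> < 1"
    and t: "\<bar>Im t\<bar> < phi_width \<alpha> \<rho>"
  shows "log_phi \<alpha> \<rho> t = log_phi (1 / \<alpha>) (\<alpha> * \<rho>) (of_real \<alpha> * t)"
proof (rule strip_primitive_unique[where f = "log_phi \<alpha> \<rho>" and g = "\<lambda>t. log_phi (1 / \<alpha>) (\<alpha> * \<rho>) (of_real \<alpha> * t)" and B = "phi_width \<alpha> \<rho>" and l = 0, OF _ _ _ _ t])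
  have p': "1 / \<alpha> > 0" "0 < \<alpha> * \<rho>" using \<alpha> \<rho> by auto
  show "((\<lambda>s::real. log_phi \<alpha> \<rho> (of_real s)) \<longlongrightarrow> 0) at_bot" by (rule log_phi_tendsto_0_real[OF \<alpha> \<rho>])
  have "filterlim (\<lambda>s::real. \<alpha> * s) at_bot at_bot" using \<alpha> by real_asymp
  from filterlim_compose[OF log_phi_tendsto_0_real[OF p' \<alpha>\<rho>] this]
  show "((\<lambda>s::real. log_phi (1 / \<alpha>) (\<alpha> * \<rho>) (of_real \<alpha> * of_real s)) \<longlongrightarrow> 0) at_bot" by simp
  fix t assume t: "\<bar>Im t\<bar> < phi_width \<alpha> \<rho>"
  then show "(log_phi \<alpha> \<rho> has_field_derivative phi_log_deriv \<alpha> \<rho> t) (at t)"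
    by (rule log_phi_has_field_derivative[OF \<alpha> \<rho>])
  have "phi_width (1 / \<alpha>) (\<alpha> * \<rho>) = \<alpha> * phi_width \<alpha> \<rho>" using \<alpha> by (simp add: phi_width_def field_simps)
  then have "\<bar>Im (of_real \<alpha> * t)\<bar> < phi_width (1 / \<alpha>) (\<alpha> * \<rho>)" using t \<alpha> by (simp add: abs_mult)
  from log_phi_has_field_derivative[OF p' \<alpha>\<rho> this]
  have "((\<lambda>t. log_phi (1 / \<alpha>) (\<alpha> * \<rho>) (of_real \<alpha> * t)) has_field_derivative phi_log_deriv (1 / \<alpha>) (\<alpha> * \<rho>) (of_real \<alpha> * t) * of_real \<alpha>) (at t)"
    by (rule DERIV_chain2[of _ _ "\<lambda>t. of_real \<alpha> * t"]) (auto intro!: derivative_eq_intros)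
  also have "phi_log_deriv (1 / \<alpha>) (\<alpha> * \<rho>) (of_real \<alpha> * t) * of_real \<alpha> = phi_log_deriv \<alpha> \<rho> t"
    unfolding phi_log_deriv_def F_ext_duality[OF \<alpha>] by (simp add: algebra_simps diff_divide_distrib)
  finally show "((\<lambda>t. log_phi (1 / \<alpha>) (\<alpha> * \<rho>) (of_real \<alpha> * t)) has_field_derivative phi_log_deriv \<alpha> \<rho> t) (at t)" .
qed

text \<open>
  The shifts have size at most \<open>(n - 1) \<pi>/\<alpha>\<close>, which is exactly by how much the strip for \<open>\<alpha>/n\<close> exceeds
  the one for \<open>\<alpha>\<close>.
\<close>
lemma log_phi_multiplication:
  assumes \<alpha>: "\<alpha> > 0" and \<rho>: "0 < \<rho>" "\<rho> < 1" and n: "n > 0"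
    and t: "\<bar>Im t\<bar> < phi_width \<alpha> \<rho>"
  shows "log_phi \<alpha> \<rho> t = (\<Sum>k = 0..n - 1. log_phi (\<alpha> / real n) \<rho> (t + \<i> * of_real ((real n - 2 * real k - 1) / \<alpha> * pi)))"
proof -
  define y where "y k = (real n - 2 * real k - 1) / \<alpha> * pi" for k
  have an: "\<alpha> / real n > 0" using \<alpha> n by simp
  have Weq: "phi_width (\<alpha> / real n) \<rho> = phi_width \<alpha> \<rho> + (real n - 1) * (pi / \<alpha>)"
    using \<alpha> by (simp add: phi_width_def field_simps)
  have yb: "\<bar>y k\<bar> \<le> (real n - 1) * (pi / \<alpha>)" if k: "k \<in> {0..n-1}" for k
  proof -
    have "\<bar>real n - 2 * real k - 1\<bar> \<le> real n - 1" using k n by (intro abs_centred_index_le) auto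
    then have "\<bar>real n - 2 * real k - 1\<bar> * (pi / \<alpha>) \<le> (real n - 1) * (pi / \<alpha>)" using \<alpha> by (intro mult_right_mono) auto
    then show ?thesis using \<alpha> by (simp add: abs_mult y_def)
  qed
  have yW: "\<bar>Im (t + \<i> * of_real (y k))\<bar> < phi_width (\<alpha> / real n) \<rho>" if "k \<in> {0..n-1}" "\<bar>Im t\<bar> < phi_width \<alpha> \<rho>" for k t
    using yb[OF that(1)] that(2) abs_triangle_ineq[of "Im t" "y k"] by (simp add: Weq)
  have W: "phi_width \<alpha> \<rho> > 0" by (rule phi_width_gt[OF \<alpha> \<rho>])
  have mult: "F_ext \<alpha> w = (\<Sum>k = 0..n - 1. F_ext (\<alpha> / real n) (w - \<i> * of_real (y k)))" if w: "\<bar>Im w\<bar> < pi + pi / \<alpha>" for w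
  proof -
    have "F_ext \<alpha> w = (\<Sum>k = 0..n - 1. F_ext (\<alpha> / real n) (w + \<i> * of_real (y k)))"
      using F_ext_multiplication[OF \<alpha> n w] by (simp add: y_def mult_ac)
    also have "\<dots> = (\<Sum>k = 0..n - 1. F_ext (\<alpha> / real n) (w + \<i> * of_real (y (n - 1 + 0 - k))))"
      by (rule sum.atLeastAtMost_rev)
    also have "\<dots> = (\<Sum>k = 0..n - 1. F_ext (\<alpha> / real n) (w - \<i> * of_real (y k)))"
    proof (rule sum.cong)
      fix k assume k: "k \<in> {0..n-1}"
      then have "real n - 2 * real (n - 1 + 0 - k) - 1 = - (real n - 2 * real k - 1)" using n by (auto simp: of_nat_diff)
      then have "y (n - 1 + 0 - k) = - y k" by (simp only: y_def minus_divide_left minus_mult_left)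
      then show "F_ext (\<alpha> / real n) (w + \<i> * of_real (y (n - 1 + 0 - k))) = F_ext (\<alpha> / real n) (w - \<i> * of_real (y k))" by simp
    qed simp
    finally show ?thesis .
  qed
  have "log_phi \<alpha> \<rho> t = (\<Sum>k = 0..n - 1. log_phi (\<alpha> / real n) \<rho> (t + \<i> * of_real (y k)))"
  proof (rule strip_primitive_unique[where f = "log_phi \<alpha> \<rho>" and g = "\<lambda>t. (\<Sum>k = 0..n - 1. log_phi (\<alpha> / real n) \<rho> (t + \<i> * of_real (y k)))" and B = "phi_width \<alpha> \<rho>" and l = 0, OF _ _ _ _ t])
    show "((\<lambda>s::real. log_phi \<alpha> \<rho> (of_real s)) \<longlongrightarrow> 0) at_bot" by (rule log_phi_tendsto_0_real[OF \<alpha> \<rho>])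
    have "((\<lambda>s::real. \<Sum>k = 0..n - 1. log_phi (\<alpha> / real n) \<rho> (of_real s + \<i> * of_real (y k))) \<longlongrightarrow> (\<Sum>k = 0..n - 1. 0)) at_bot"
      using yW[of _ 0] W by (intro tendsto_sum log_phi_tendsto_0[OF an \<rho>]) auto
    then show "((\<lambda>s::real. \<Sum>k = 0..n - 1. log_phi (\<alpha> / real n) \<rho> (of_real s + \<i> * of_real (y k))) \<longlongrightarrow> 0) at_bot" by simp
    fix t assume t: "\<bar>Im t\<bar> < phi_width \<alpha> \<rho>"
    then show "(log_phi \<alpha> \<rho> has_field_derivative phi_log_deriv \<alpha> \<rho> t) (at t)"
      by (rule log_phi_has_field_derivative[OF \<alpha> \<rho>])
    have "((\<lambda>t. \<Sum>k = 0..n - 1. log_phi (\<alpha> / real n) \<rho> (t + \<i> * of_real (y k))) has_field_derivative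
        (\<Sum>k = 0..n - 1. phi_log_deriv (\<alpha> / real n) \<rho> (t + \<i> * of_real (y k)) * 1)) (at t)"
      by (intro DERIV_sum DERIV_chain2[of _ _ "\<lambda>t. t + \<i> * of_real (y k)" for k, OF log_phi_has_field_derivative[OF an \<rho>]] yW t)
        (auto intro!: derivative_eq_intros)
    also have "(\<Sum>k = 0..n - 1. phi_log_deriv (\<alpha> / real n) \<rho> (t + \<i> * of_real (y k)) * 1) = phi_log_deriv \<alpha> \<rho> t"
      unfolding phi_log_deriv_def mult[OF Im_shift_bounds(1)[OF \<rho>(1) t]] mult[OF Im_shift_bounds(2)[OF \<rho>(1) t]]
      by (simp add: sum_divide_distrib[symmetric] sum_subtractf[symmetric] diff_diff_eq)
    finally show "((\<lambda>t. \<Sum>k = 0..n - 1. log_phi (\<alpha> / real n) \<rho> (t + \<i> * of_real (y k))) has_field_derivative phi_log_deriv \<alpha> \<rho> t) (at t)" .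
  qed
  then show ?thesis by (simp add: y_def)
qed

text \<open>
  The sum of the two logarithmic derivatives is a jump of \<open>F\<close> across a strip of width \<open>2 \<pi>\<close>, hence
  elementary, so the product is constant; it tends to \<open>1\<close> along the line \<open>Im t = - \<pi> (1 - \<rho>)\<close>, which lies
  in the overlap of the two strips for all parameters.
\<close>
lemma log_phi_complement:
  assumes \<alpha>: "\<alpha> > 0" and \<rho>: "0 < \<rho>" "\<rho> < 1"
    and t: "\<bar>Im t\<bar> < phi_width \<alpha> \<rho>" "\<bar>Im (t + \<i> * of_real pi)\<bar> < phi_width \<alpha> (1 - \<rho>)"
  shows "exp (log_phi \<alpha> (1 - \<rho>) (t + \<i> * of_real pi)) * exp (log_phi \<alpha> \<rho> t) *
     (1 + exp (of_real \<alpha> * (t + \<i> * of_real pi) - \<i> * of_real (pi * \<alpha> * \<rho>))) = 1"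
proof -
  have \<rho>': "0 < 1 - \<rho>" "1 - \<rho> < 1" using \<rho> by auto
  define R where "R = strip (phi_width \<alpha> \<rho>) \<inter> (\<lambda>t. t + \<i> * of_real pi) -` strip (phi_width \<alpha> (1 - \<rho>))"
  define H1 where "H1 t = log_phi \<alpha> (1 - \<rho>) (t + \<i> * of_real pi)" for t
  define H2 where "H2 = log_phi \<alpha> \<rho>"
  define X where "X t = exp (of_real \<alpha> * (t + \<i> * of_real pi) - \<i> * of_real (pi * \<alpha> * \<rho>))" for t :: complex
  define E where "E t = exp (H1 t) * exp (H2 t) * (1 + X t)" for t
  have "R = {t. Im t < min (phi_width \<alpha> \<rho>) (phi_width \<alpha> (1 - \<rho>) - pi)} \<inter> {t. Im t > max (- phi_width \<alpha> \<rho>) (- phi_width \<alpha> (1 - \<rho>) - pi)}"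
    by (auto simp: R_def strip_def)
  then have convR: "convex R" by (simp only: convex_Int convex_halfspace_Im_lt convex_halfspace_Im_gt)
  have deriv: "(E has_field_derivative 0) (at z)" if z: "z \<in> R" for z
  proof -
    define w where "w = \<i> * of_real (pi * \<rho>) - z - \<i> * of_real pi"
    have z1: "\<bar>Im z\<bar> < phi_width \<alpha> \<rho>" and z2: "\<bar>Im (z + \<i> * of_real pi)\<bar> < phi_width \<alpha> (1 - \<rho>)"
      using z by (auto simp: R_def strip_def)
    have w: "\<bar>Im w\<bar> < pi / \<alpha>"
      using z1 z2 by (auto simp: w_def phi_width_def abs_less_iff algebra_simps)
    have Xw: "X z * exp (of_real \<alpha> * w) = 1"
      by (simp add: X_def w_def exp_add[symmetric] algebra_simps)
    have "\<bar>Im (of_real \<alpha> * w)\<bar> < pi" using w \<alpha> by (simp add: abs_mult field_simps)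
    then have n0: "1 + exp (of_real \<alpha> * w) \<noteq> 0" by (rule one_plus_exp_neq_0)
    have sumL: "phi_log_deriv \<alpha> (1 - \<rho>) (z + \<i> * of_real pi) + phi_log_deriv \<alpha> \<rho> z = - of_real \<alpha> * fermi (of_real \<alpha> * w)"
    proof -
      have e: "\<i> * of_real (pi * (1 - \<rho>)) - (z + \<i> * of_real pi) = - \<i> * of_real (pi * \<rho>) - z"
        "- \<i> * of_real (pi * (1 - \<rho>)) - (z + \<i> * of_real pi) = w - \<i> * of_real pi"
        "\<i> * of_real (pi * \<rho>) - z = w + \<i> * of_real pi"
        by (simp_all add: w_def algebra_simps)
      have "phi_log_deriv \<alpha> (1 - \<rho>) (z + \<i> * of_real pi) + phi_log_deriv \<alpha> \<rho> z =
         (F_ext \<alpha> (w + \<i> * of_real pi) - F_ext \<alpha> (w - \<i> * of_real pi)) / (2 * of_real pi * \<i>)"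
        unfolding phi_log_deriv_def e by (simp add: add_divide_distrib[symmetric])
      then show ?thesis unfolding F_ext_jump[OF \<alpha> w] by simp
    qed
    have d1: "(H1 has_field_derivative phi_log_deriv \<alpha> (1 - \<rho>) (z + \<i> * of_real pi) * 1) (at z)"
      unfolding H1_def by (rule DERIV_chain2[of _ _ "\<lambda>t. t + \<i> * of_real pi", OF log_phi_has_field_derivative[OF \<alpha> \<rho>' z2]]) (auto intro!: derivative_eq_intros)
    have d2: "(H2 has_field_derivative phi_log_deriv \<alpha> \<rho> z) (at z)"
      unfolding H2_def by (rule log_phi_has_field_derivative[OF \<alpha> \<rho> z1])
    have d3: "(X has_field_derivative of_real \<alpha> * X z) (at z)"
      unfolding X_def by (auto intro!: derivative_eq_intros)
    have "(E has_field_derivative exp (H1 z) * exp (H2 z) * ((phi_log_deriv \<alpha> (1 - \<rho>) (z + \<i> * of_real pi) + phi_log_deriv \<alpha> \<rho> z) * (1 + X z) + of_real \<alpha> * X z)) (at z)"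
      unfolding E_def using d1 d2 d3 by (auto intro!: derivative_eq_intros simp: algebra_simps)
    also have "(phi_log_deriv \<alpha> (1 - \<rho>) (z + \<i> * of_real pi) + phi_log_deriv \<alpha> \<rho> z) * (1 + X z) + of_real \<alpha> * X z = 0"
    proof -
      have "X z = 1 / exp (of_real \<alpha> * w)" using Xw by (simp add: field_simps)
      then show ?thesis unfolding sumL fermi_def using n0 by (simp add: field_simps)
    qed
    finally show ?thesis by simp
  qed
  from has_field_derivative_zero_constant[OF convR has_field_derivative_at_within[OF this]]
  obtain k where k: "\<And>z. z \<in> R \<Longrightarrow> E z = k" by blast
  \<comment> \<open>The centre line of the overlap of the two strips.\<close>
  define y where "y = - (pi * (1 - \<rho>))"
  have y: "\<bar>y\<bar> < phi_width \<alpha> \<rho>" "\<bar>y + pi\<bar> < phi_width \<alpha> (1 - \<rho>)"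
    using \<alpha> \<rho> by (auto simp: y_def phi_width_def abs_mult algebra_simps)
  have kE: "E (of_real s + \<i> * of_real y) = k" for s :: real
    using y by (intro k) (auto simp: R_def strip_def)
  have "((\<lambda>s::real. E (of_real s + \<i> * of_real y)) \<longlongrightarrow> exp 0 * exp 0 * (1 + 0)) at_bot"
    unfolding E_def
  proof (intro tendsto_intros)
    show "((\<lambda>s::real. H2 (of_real s + \<i> * of_real y)) \<longlongrightarrow> 0) at_bot"
      unfolding H2_def by (rule log_phi_tendsto_0[OF \<alpha> \<rho> y(1)])
    show "((\<lambda>s::real. H1 (of_real s + \<i> * of_real y)) \<longlongrightarrow> 0) at_bot"
      using log_phi_tendsto_0[OF \<alpha> \<rho>' y(2)] by (simp add: H1_def algebra_simps)
    show "((\<lambda>s::real. X (of_real s + \<i> * of_real y)) \<longlongrightarrow> 0) at_bot"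
    proof (rule Lim_null_comparison)
      show "\<forall>\<^sub>F s in at_bot. norm (X (of_real s + \<i> * of_real y)) \<le> exp (\<alpha> * s)"
        by (simp add: X_def norm_exp_eq_Re)
      show "((\<lambda>s. exp (\<alpha> * s)) \<longlongrightarrow> 0) at_bot" using \<alpha> by real_asymp
    qed
  qed
  then have "k = 1" unfolding kE by (simp add: tendsto_const_iff)
  then have "E t = 1" using k[of t] t by (auto simp: R_def strip_def)
  then show ?thesis by (simp add: E_def H1_def H2_def X_def)
qed

section \<open>The meromorphic continuation\<close>

lemma sector_pi_iff: "z \<in> sector pi \<longleftrightarrow> z \<notin> \<real>\<^sub>\<le>\<^sub>0"
proof -
  have "\<bar>Arg z\<bar> < pi \<longleftrightarrow> Arg z \<noteq> pi" using mpi_less_Arg[of z] Arg_le_pi[of z] by auto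
  then show ?thesis
    by (auto simp: sector_def Arg_eq_pi complex_nonpos_Reals_iff complex_eq_iff)
qed

lemma sector_conv_Ln: "\<theta> \<le> pi \<Longrightarrow> sector \<theta> = sector pi \<inter> Ln -` strip \<theta>"
  by (auto simp: sector_def strip_def Arg_eq_Im_Ln)

lemma sector_eq_exp_image: "\<theta> \<le> pi \<Longrightarrow> sector \<theta> = exp ` strip \<theta>"
proof (intro equalityI subsetI)
  fix z assume "\<theta> \<le> pi" "z \<in> sector \<theta>"
  then have "z = exp (Ln z)" "Ln z \<in> strip \<theta>" by (auto simp: sector_def strip_def Arg_eq_Im_Ln)
  then show "z \<in> exp ` strip \<theta>" by blast
qed (auto simp: sector_def strip_def Arg_exp)

lemma open_sector: "\<theta> \<le> pi \<Longrightarrow> open (sector \<theta>)"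
proof -
  assume \<theta>: "\<theta> \<le> pi"
  have "open (sector pi)"
  proof -
    have "sector pi = - \<real>\<^sub>\<le>\<^sub>0" using sector_pi_iff by blast
    then show ?thesis using closed_nonpos_Reals_complex by (simp add: open_Compl)
  qed
  then show ?thesis
    unfolding sector_conv_Ln[OF \<theta>]
    by (intro continuous_open_preimage continuous_on_Ln open_strip) (auto simp: sector_pi_iff)
qed

lemma connected_sector: "\<theta> \<le> pi \<Longrightarrow> connected (sector \<theta>)"
  unfolding sector_eq_exp_image
  by (intro connected_continuous_image continuous_intros convex_connected convex_strip)

text \<open>
  The difference vanishes either almost everywhere or almost nowhere, and a limit point of zeros in
  the domain rules out the latter.
\<close>
lemma meromorphic_identity:
  assumes mero: "f meromorphic_on S" "g meromorphic_on S" and S: "open S" "connected S" "z0 \<in> S"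
    and freq: "\<exists>\<^sub>F z in at z0. f z = g z"
  shows "\<forall>\<^sub>\<approx>z\<in>S. f z = g z"
proof -
  have "(\<lambda>z. f z - g z) meromorphic_on S" using mero by (intro meromorphic_intros)
  from meromorphic_imp_constant_or_avoid[OF this S(1,2), of 0]
  show ?thesis
  proof
    assume "\<forall>\<^sub>\<approx>z\<in>S. f z - g z \<noteq> 0"
    then have "\<forall>\<^sub>F z in at z0. f z - g z \<noteq> 0"
      using S by (simp add: eventually_cosparse_open_eq)
    then show ?thesis using freq by (auto simp: frequently_def elim: eventually_mono)
  qed simp
qed

lemma frequently_eq_if_eq_on_ray:
  fixes f g :: "complex \<Rightarrow> complex"
  assumes "\<And>s::real. f (exp (of_real s + \<i> * of_real y)) = g (exp (of_real s + \<i> * of_real y))"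
  shows "\<exists>\<^sub>F z in at (exp (\<i> * of_real y)). f z = g z"
proof -
  define x where "x n = exp (of_real (1 / real (Suc n)) + \<i> * of_real y)" for n
  have "exp (\<i> * of_real y) islimpt {z. f z = g z}"
    unfolding islimpt_sequential
  proof (intro exI[of _ x] conjI allI)
    fix n
    have "norm (x n) = exp (1 / real (Suc n))" by (simp add: x_def norm_exp_eq_Re)
    moreover have "norm (exp (\<i> * of_real y)) = exp 0" by (simp add: norm_exp_eq_Re)
    ultimately have "x n \<noteq> exp (\<i> * of_real y)" by (metis exp_inj_iff divide_eq_0_iff of_nat_eq_0_iff nat.distinct(1) zero_neq_one)
    then show "x n \<in> {z. f z = g z} - {exp (\<i> * of_real y)}" using assms unfolding x_def by blast
  next
    have "x \<longlonglongrightarrow> exp (of_real 0 + \<i> * of_real y)"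
      unfolding x_def by (intro tendsto_intros LIMSEQ_Suc lim_1_over_n)
    then show "x \<longlonglongrightarrow> exp (\<i> * of_real y)" by simp
  qed
  then show ?thesis by (simp add: islimpt_conv_frequently_at)
qed

text \<open>
  Replacing \<open>\<rho>\<close> by \<open>1 - \<rho>\<close> and \<open>t\<close> by \<open>t - \<pi> i\<close> gives the relation with the opposite shift.
\<close>
lemma log_phi_complement_signed:
  assumes \<alpha>: "\<alpha> > 0" and \<rho>: "0 < \<rho>" "\<rho> < 1" and \<delta>: "\<delta> \<in> {1, -1::real}"
    and t: "\<bar>Im t\<bar> < phi_width \<alpha> \<rho>" "\<bar>Im t + \<delta> * pi\<bar> < phi_width \<alpha> (1 - \<rho>)"
  shows "exp (log_phi \<alpha> (1 - \<rho>) (t + \<i> * of_real (\<delta> * pi))) * exp (log_phi \<alpha> \<rho> t) *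
     (1 + exp (of_real \<alpha> * (t + \<i> * of_real (\<delta> * pi)) - \<i> * of_real (\<delta> * pi * \<alpha> * \<rho>))) = 1"
proof (cases "\<delta> = 1")
  case True
  then show ?thesis using log_phi_complement[OF \<alpha> \<rho>, of t] t by simp
next
  case False
  then have d: "\<delta> = -1" using \<delta> by simp
  have "of_real \<alpha> * t - \<i> * of_real (pi * \<alpha> * (1 - \<rho>)) = of_real \<alpha> * (t + \<i> * of_real (\<delta> * pi)) - \<i> * of_real (\<delta> * pi * \<alpha> * \<rho>)"
    by (simp add: d algebra_simps)
  then show ?thesis
    using log_phi_complement[OF \<alpha>, of "1 - \<rho>" "t - \<i> * of_real pi"] \<rho> t d by (simp add: mult.commute mult.left_commute)
qed

text \<open>
  The value of \<open>exp (log_phi \<alpha> \<rho> t)\<close> that \<open>log_phi_complement_signed\<close> prescribes. It makes sense for \<open>t\<close>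
  closer to the line \<open>Im t = - \<delta> \<pi>\<close> than the strip of \<open>log_phi \<alpha> \<rho>\<close> reaches, with poles at the zeros of
  the last factor.
\<close>
definition phi_sheet :: "real \<Rightarrow> real \<Rightarrow> real \<Rightarrow> complex \<Rightarrow> complex" where
  "phi_sheet \<alpha> \<rho> \<delta> t = inverse (exp (log_phi \<alpha> (1 - \<rho>) (t + \<i> * of_real (\<delta> * pi))) *
     (1 + exp (of_real \<alpha> * (t + \<i> * of_real (\<delta> * pi)) - \<i> * of_real (\<delta> * pi * \<alpha> * \<rho>))))"

text \<open>
  Beyond the strip of \<open>log_phi\<close> the shift goes towards the real axis, hence the sign of \<open>Im (Ln z)\<close> is
  reversed.
\<close>
definition phi_cont :: "real \<Rightarrow> real \<Rightarrow> complex \<Rightarrow> complex" where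
  "phi_cont \<alpha> \<rho> z = (if \<bar>Im (Ln z)\<bar> < phi_width \<alpha> \<rho> then exp (log_phi \<alpha> \<rho> (Ln z))
     else phi_sheet \<alpha> \<rho> (- sgn (Im (Ln z))) (Ln z))"

lemma Im_Ln_eventually:
  assumes "z0 \<notin> \<real>\<^sub>\<le>\<^sub>0" "open U" "Im (Ln z0) \<in> U"
  shows "\<forall>\<^sub>F z in nhds z0. Im (Ln z) \<in> U"
proof -
  have "isCont Ln z0" using assms(1) by (rule continuous_at_Ln)
  then have "((\<lambda>z. Im (Ln z)) \<longlongrightarrow> Im (Ln z0)) (nhds z0)"
    by (intro tendsto_Im) (simp add: isCont_def tendsto_nhds_iff)
  then show ?thesis using assms(2,3) by (rule topological_tendstoD)
qed

lemma phi_cont_analytic_at: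
  assumes \<alpha>: "\<alpha> > 0" and \<rho>: "0 < \<rho>" "\<rho> < 1"
    and z0: "z0 \<notin> \<real>\<^sub>\<le>\<^sub>0" "\<bar>Im (Ln z0)\<bar> < phi_width \<alpha> \<rho>"
  shows "phi_cont \<alpha> \<rho> analytic_on {z0}"
proof -
  have "\<forall>\<^sub>F z in nhds z0. Im (Ln z) \<in> {- phi_width \<alpha> \<rho><..<phi_width \<alpha> \<rho>}"
    using z0(2) by (intro Im_Ln_eventually z0(1)) auto
  then have ev: "\<forall>\<^sub>F z in nhds z0. phi_cont \<alpha> \<rho> z = exp (log_phi \<alpha> \<rho> (Ln z))"
    by eventually_elim (auto simp: phi_cont_def)
  have "Ln analytic_on {z0}" using z0 by (intro analytic_intros) auto
  then have "log_phi \<alpha> \<rho> \<circ> Ln analytic_on {z0}"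
    by (rule analytic_on_compose_gen[OF _ log_phi_analytic[OF \<alpha> \<rho>]]) (use z0 in \<open>auto simp: strip_def\<close>)
  then have "(\<lambda>z. exp (log_phi \<alpha> \<rho> (Ln z))) analytic_on {z0}"
    by (intro analytic_intros) (simp add: o_def)
  then show ?thesis using analytic_at_cong[OF ev refl] by simp
qed

text \<open>
  The case distinction in \<open>phi_cont\<close> is harmless: near a point outside the strip the sheet formula is
  also valid on the part of the neighbourhood that lies inside it.
\<close>
lemma phi_cont_meromorphic:
  assumes \<alpha>: "\<alpha> > 0" and \<rho>: "0 < \<rho>" "\<rho> < 1"
  shows "phi_cont \<alpha> \<rho> meromorphic_on sector pi"
proof (subst meromorphic_on_meromorphic_at, intro ballI)
  fix z0 assume z0: "z0 \<in> sector pi"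
  then have z0': "z0 \<notin> \<real>\<^sub>\<le>\<^sub>0" by (simp add: sector_pi_iff)
  have \<rho>': "0 < 1 - \<rho>" "1 - \<rho> < 1" using \<rho> by auto
  have lnan: "Ln analytic_on {z0}" using z0' by (intro analytic_intros) auto
  show "phi_cont \<alpha> \<rho> meromorphic_on {z0}"
  proof (cases "\<bar>Im (Ln z0)\<bar> < phi_width \<alpha> \<rho>")
    case True
    then show ?thesis
      by (intro analytic_on_imp_meromorphic_on phi_cont_analytic_at \<alpha> \<rho> z0')
  next
    case False
    define \<delta> where "\<delta> = - sgn (Im (Ln z0))"
    have W: "phi_width \<alpha> \<rho> > 0" by (rule phi_width_gt[OF \<alpha> \<rho>])
    have ne: "Im (Ln z0) \<noteq> 0" using False W by auto
    then have \<delta>: "\<delta> \<in> {1, -1}" by (auto simp: \<delta>_def sgn_real_def)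
    have lt: "\<bar>Im (Ln z0)\<bar> < pi" using mpi_less_Im_Ln[of z0] Im_Ln_less_pi[OF z0'] z0' by fastforce
    have sh: "\<bar>Im (Ln z0) + \<delta> * pi\<bar> < phi_width \<alpha> (1 - \<rho>)"
    proof -
      have "\<bar>Im (Ln z0) + \<delta> * pi\<bar> = pi - \<bar>Im (Ln z0)\<bar>"
        using lt ne by (auto simp: \<delta>_def sgn_real_def)
      also have "\<dots> \<le> pi * \<rho> - pi / \<alpha>" using False by (simp add: phi_width_def algebra_simps)
      also have "\<dots> < phi_width \<alpha> (1 - \<rho>)" using \<alpha> by (simp add: phi_width_def)
      finally show ?thesis .
    qed
    have "(\<lambda>z. Ln z + \<i> * of_real (\<delta> * pi)) analytic_on {z0}"
      by (intro analytic_on_add lnan analytic_on_const)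
    then have "log_phi \<alpha> (1 - \<rho>) \<circ> (\<lambda>z. Ln z + \<i> * of_real (\<delta> * pi)) analytic_on {z0}"
      by (rule analytic_on_compose_gen[OF _ log_phi_analytic[OF \<alpha> \<rho>']]) (use sh in \<open>auto simp: strip_def\<close>)
    then have "(\<lambda>z. log_phi \<alpha> (1 - \<rho>) (Ln z + \<i> * of_real (\<delta> * pi))) analytic_on {z0}"
      by (simp add: o_def)
    then have "(\<lambda>z. phi_sheet \<alpha> \<rho> \<delta> (Ln z)) meromorphic_on {z0}"
      unfolding phi_sheet_def using z0'
      by (intro meromorphic_on_inverse analytic_on_imp_meromorphic_on analytic_intros) auto
    moreover have "\<forall>\<^sub>F z in at z0. phi_cont \<alpha> \<rho> z = phi_sheet \<alpha> \<rho> \<delta> (Ln z)"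
    proof -
      define U where "U = {y. sgn (Im (Ln z0)) * y > 0} \<inter> {y. \<bar>y + \<delta> * pi\<bar> < phi_width \<alpha> (1 - \<rho>)}"
      have "open U" unfolding U_def by (intro open_Int open_Collect_less continuous_intros)
      moreover have "Im (Ln z0) \<in> U" using sh ne by (auto simp: U_def sgn_real_def)
      ultimately have "\<forall>\<^sub>F z in nhds z0. Im (Ln z) \<in> U" by (intro Im_Ln_eventually z0')
      then have "\<forall>\<^sub>F z in at z0. Im (Ln z) \<in> U"
        by (rule eventually_nhds_conv_at[THEN iffD1, THEN conjunct1])
      then show ?thesis
      proof eventually_elim
        case (elim z)
        have sg: "sgn (Im (Ln z)) = sgn (Im (Ln z0))" using elim ne by (auto simp: U_def sgn_real_def split: if_splits)
        have "exp (log_phi \<alpha> \<rho> (Ln z)) = phi_sheet \<alpha> \<rho> \<delta> (Ln z)" if "\<bar>Im (Ln z)\<bar> < phi_width \<alpha> \<rho>"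
          unfolding phi_sheet_def using log_phi_complement_signed[OF \<alpha> \<rho> \<delta> that] elim
          by (intro inverse_unique[symmetric]) (auto simp: U_def mult_ac)
        then show ?case by (simp add: phi_cont_def sg \<delta>_def)
      qed
    qed
    ultimately show ?thesis using meromorphic_on_cong[of "{z0}"] by fastforce
  qed
qed

lemma nicely_meromorphic_eqI:
  assumes f: "f nicely_meromorphic_on S" and g: "g nicely_meromorphic_on S"
    and eq: "\<forall>\<^sub>\<approx>z\<in>S. f z = g z" and z: "z \<in> S"
  shows "f z = g z"
proof -
  have ev: "\<forall>\<^sub>F w in at z. f w = g w" using eventually_cosparse_imp_eventually_at[OF eq z] .
  have p: "is_pole f z \<longleftrightarrow> is_pole g z" by (rule is_pole_cong[OF ev refl])
  show ?thesis
  proof (cases "is_pole f z")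
    case True
    then have "f z = 0" "g z = 0"
      using f g p z not_tendsto_and_filterlim_at_infinity[of "at z"] unfolding nicely_meromorphic_on_def is_pole_def
      by fastforce+
    then show ?thesis by simp
  next
    case False
    then have "f \<midarrow>z\<rightarrow> f z" "g \<midarrow>z\<rightarrow> g z" using f g p z by (auto simp: nicely_meromorphic_on_def)
    moreover from this(1) have "g \<midarrow>z\<rightarrow> f z" using tendsto_cong[OF ev] by blast
    ultimately show ?thesis by (metis LIM_unique)
  qed
qed

text \<open>
  Existence of a function as in the definition of \<open>phi\<close> comes from \<open>phi_cont\<close>, uniqueness from the identity
  theorem on the positive half-line.
\<close>
lemma phi_eq_remove_sings:
  assumes \<alpha>: "\<alpha> > 0" and \<rho>: "0 < \<rho>" "\<rho> < 1"
  shows "phi z \<alpha> \<rho> = (if z \<in> sector pi then remove_sings (phi_cont \<alpha> \<rho>) z else 0)"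
proof -
  define f0 where "f0 z = (if z \<in> sector pi then remove_sings (phi_cont \<alpha> \<rho>) z else 0)" for z
  have op: "open (sector pi)" by (simp add: open_sector)
  have W: "phi_width \<alpha> \<rho> > 0" by (rule phi_width_gt[OF \<alpha> \<rho>])
  have rs: "remove_sings (phi_cont \<alpha> \<rho>) nicely_meromorphic_on sector pi"
    by (intro remove_sings_nicely_meromorphic phi_cont_meromorphic \<alpha> \<rho>)
  have ev: "\<forall>\<^sub>F w in at z. f0 w = remove_sings (phi_cont \<alpha> \<rho>) w" if "z \<in> sector pi" for z
    using eventually_at_in_open'[OF op that] by eventually_elim (simp add: f0_def)
  have f0: "f0 nicely_meromorphic_on sector pi"
    unfolding nicely_meromorphic_on_def
  proof (intro conjI ballI)
    show "f0 meromorphic_on sector pi"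
      using rs ev meromorphic_on_cong[of "sector pi" f0 "remove_sings (phi_cont \<alpha> \<rho>)" "sector pi"] by (auto simp: nicely_meromorphic_on_def)
    fix z assume z: "z \<in> sector pi"
    have "f0 z = remove_sings (phi_cont \<alpha> \<rho>) z" using z by (simp add: f0_def)
    then show "is_pole f0 z \<and> f0 z = 0 \<or> f0 \<midarrow>z\<rightarrow> f0 z"
      using rs z is_pole_cong[OF ev[OF z] refl] tendsto_cong[OF ev[OF z]] by (simp add: nicely_meromorphic_on_def)
  qed
  have pos: "f0 (of_real x) = phi_pos \<alpha> \<rho> x" if x: "x > 0" for x
  proof -
    have xs: "complex_of_real x \<notin> \<real>\<^sub>\<le>\<^sub>0" using x by simp
    have "phi_cont \<alpha> \<rho> analytic_on {of_real x}"
      using x W by (intro phi_cont_analytic_at \<alpha> \<rho> xs) (simp add: Ln_of_real)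
    then have "f0 (of_real x) = phi_cont \<alpha> \<rho> (of_real x)" using xs by (simp add: f0_def sector_pi_iff)
    also have "\<dots> = exp (log_phi \<alpha> \<rho> (of_real (ln x)))" using x W by (simp add: phi_cont_def Ln_of_real)
    also have "\<dots> = phi_pos \<alpha> \<rho> x" using phi_pos_exp[OF \<alpha> \<rho>, of "ln x"] x by simp
    finally show ?thesis .
  qed
  have "(THE f. f nicely_meromorphic_on sector pi \<and> (\<forall>x>0. f (of_real x) = phi_pos \<alpha> \<rho> x) \<and>
             (\<forall>w. w \<notin> sector pi \<longrightarrow> f w = 0)) = f0"
  proof (rule the_equality)
    show "f0 nicely_meromorphic_on sector pi \<and> (\<forall>x>0. f0 (of_real x) = phi_pos \<alpha> \<rho> x) \<and> (\<forall>w. w \<notin> sector pi \<longrightarrow> f0 w = 0)"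
      using f0 pos by (auto simp: f0_def)
  next
    fix f assume f: "f nicely_meromorphic_on sector pi \<and> (\<forall>x>0. f (of_real x) = phi_pos \<alpha> \<rho> x) \<and> (\<forall>w. w \<notin> sector pi \<longrightarrow> f w = 0)"
    have "f (exp (of_real s + \<i> * of_real 0)) = f0 (exp (of_real s + \<i> * of_real 0))" for s :: real
      using f pos[of "exp s"] by (simp add: exp_of_real)
    from frequently_eq_if_eq_on_ray[of f 0 f0, OF this]
    have freq: "\<exists>\<^sub>F z in at 1. f z = f0 z" by simp
    have "\<forall>\<^sub>\<approx>z\<in>sector pi. f z = f0 z"
      by (rule meromorphic_identity[OF _ _ op connected_sector _ freq])
         (use f f0 in \<open>auto simp: nicely_meromorphic_on_def sector_pi_iff\<close>)
    then have "f z = f0 z" if "z \<in> sector pi" for z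
      using nicely_meromorphic_eqI[of f "sector pi" f0 z] f f0 that by blast
    then show "f = f0" using f by (auto simp: f0_def)
  qed
  then show ?thesis unfolding phi_def by (simp add: f0_def)
qed

lemma phi_meromorphic:
  assumes \<alpha>: "\<alpha> > 0" and \<rho>: "0 < \<rho>" "\<rho> < 1"
  shows "(\<lambda>z. phi z \<alpha> \<rho>) meromorphic_on sector pi"
proof -
  have "\<forall>\<^sub>F w in at z. phi w \<alpha> \<rho> = remove_sings (phi_cont \<alpha> \<rho>) w" if "z \<in> sector pi" for z
    using eventually_at_in_open'[OF open_sector[OF order_refl] that]
    by eventually_elim (simp add: phi_eq_remove_sings[OF assms])
  moreover have "remove_sings (phi_cont \<alpha> \<rho>) meromorphic_on sector pi"
    by (intro remove_sings_meromorphic phi_cont_meromorphic \<alpha> \<rho>)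
  ultimately show ?thesis
    using meromorphic_on_cong[of "sector pi" "\<lambda>z. phi z \<alpha> \<rho>" "remove_sings (phi_cont \<alpha> \<rho>)" "sector pi"] by blast
qed

text \<open>
  The only formula for values of \<open>phi\<close> that the identities need; it covers points off the positive
  half-line, where \<open>phi_pos\<close> says nothing.
\<close>
lemma phi_exp:
  assumes \<alpha>: "\<alpha> > 0" and \<rho>: "0 < \<rho>" "\<rho> < 1" and t: "\<bar>Im t\<bar> < pi" "\<bar>Im t\<bar> < phi_width \<alpha> \<rho>"
  shows "phi (exp t) \<alpha> \<rho> = exp (log_phi \<alpha> \<rho> t)"
proof -
  have Ln: "Ln (exp t) = t" using t by simp
  have s: "exp t \<in> sector pi" using t by (auto simp: sector_def Arg_exp)
  then have ns: "exp t \<notin> \<real>\<^sub>\<le>\<^sub>0" by (simp add: sector_pi_iff)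
  then have "phi_cont \<alpha> \<rho> analytic_on {exp t}"
    using t by (intro phi_cont_analytic_at \<alpha> \<rho>) (auto simp: Ln)
  then show ?thesis using s t by (simp add: phi_eq_remove_sings[OF \<alpha> \<rho>] phi_cont_def Ln)
qed

section \<open>The identities for \<open>\<phi>\<close>\<close>

lemma mero_eq_if_eq_on_ray:
  assumes S: "open S" "connected S" and y: "exp (\<i> * of_real y) \<in> S"
    and mero: "f meromorphic_on S" "g meromorphic_on S"
    and eq: "\<And>s::real. f (exp (of_real s + \<i> * of_real y)) = g (exp (of_real s + \<i> * of_real y))"
  shows "mero_eq S f g"
  unfolding mero_eq_def
  using meromorphic_identity[OF mero S y frequently_eq_if_eq_on_ray[of f y g, OF eq]] mero by blast

lemma mero_eq_sectorI:
  assumes \<theta>: "0 < \<theta>" "\<theta> \<le> pi"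
    and mero: "f meromorphic_on sector \<theta>" "g meromorphic_on sector \<theta>"
    and eq: "\<And>s::real. f (exp (of_real s)) = g (exp (of_real s))"
  shows "mero_eq (sector \<theta>) f g"
  using \<theta> by (intro mero_eq_if_eq_on_ray[where y = 0] open_sector connected_sector mero)
    (auto simp: eq sector_def)

lemma mero_eq_Un:
  assumes "open S" "open T" "mero_eq S f g" "mero_eq T f g"
  shows "mero_eq (S \<union> T) f g"
  using assms unfolding mero_eq_def
  by (auto simp: eventually_cosparse_open_eq[OF open_Un] eventually_cosparse_open_eq meromorphic_on_Un)

lemma sector_mono: "\<theta> \<le> \<theta>' \<Longrightarrow> sector \<theta> \<subseteq> sector \<theta>'"
  by (auto simp: sector_def)

lemma phi_exp_of_real:
  assumes \<alpha>: "\<alpha> > 0" and \<rho>: "0 < \<rho>" "\<rho> < 1"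
  shows "phi (exp (of_real s)) \<alpha> \<rho> = exp (log_phi \<alpha> \<rho> (of_real s))"
  using phi_width_gt[OF assms] by (intro phi_exp assms) auto

lemma phi_inversion:
  assumes \<alpha>: "\<alpha> > 0" and \<rho>: "0 < \<rho>" "\<rho> < 1"
  shows "mero_eq (sector pi) (\<lambda>z. phi (1 / z) \<alpha> \<rho>) (\<lambda>z. z powr of_real (\<alpha> * \<rho>) * phi z \<alpha> \<rho>)"
proof (rule mero_eq_sectorI)
  have nz: "z \<noteq> 0" if "z \<in> sector pi" for z using that by (auto simp: sector_def)
  have "(\<lambda>z. 1 / z) ` sector pi \<subseteq> sector pi"
    unfolding sector_eq_exp_image[OF order_refl]
  proof clarify
    fix t assume t: "t \<in> strip pi"
    have "1 / exp t = exp (- t)" by (simp add: exp_minus field_simps)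
    then show "1 / exp t \<in> exp ` strip pi" using t by (auto simp: strip_def)
  qed
  then show "(\<lambda>z. phi (1 / z) \<alpha> \<rho>) meromorphic_on sector pi"
    by (intro meromorphic_on_compose[OF phi_meromorphic[OF assms]] analytic_intros nz)
  show "(\<lambda>z. z powr of_real (\<alpha> * \<rho>) * phi z \<alpha> \<rho>) meromorphic_on sector pi"
    by (intro meromorphic_on_mult phi_meromorphic assms analytic_on_imp_meromorphic_on analytic_intros)
       (auto simp: sector_pi_iff)
  fix s :: real
  have e: "1 / exp (complex_of_real s) = exp (of_real (- s))" by (simp add: exp_minus field_simps)
  have "log_phi \<alpha> \<rho> (of_real (- s)) = log_phi \<alpha> \<rho> (of_real s) + of_real (\<alpha> * \<rho>) * of_real s"
    using log_phi_neg[OF assms, of "of_real s"] phi_width_gt[OF assms] by simp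
  then show "phi (1 / exp (of_real s)) \<alpha> \<rho> = exp (of_real s) powr of_real (\<alpha> * \<rho>) * phi (exp (of_real s)) \<alpha> \<rho>"
    unfolding e phi_exp_of_real[OF assms] by (simp add: powr_def exp_add)
qed auto

lemma phi_duality:
  assumes \<alpha>: "\<alpha> > 0" and \<rho>: "0 < \<rho>" "\<rho> < 1" and \<alpha>\<rho>: "\<alpha> * \<rho> < 1"
  shows "mero_eq (sector (pi * min 1 (1 / \<alpha>))) (\<lambda>z. phi z \<alpha> \<rho>) (\<lambda>z. phi (z powr of_real \<alpha>) (1 / \<alpha>) (\<alpha> * \<rho>))"
proof (rule mero_eq_sectorI)
  define \<theta> where "\<theta> = pi * min 1 (1 / \<alpha>)"
  have p': "1 / \<alpha> > 0" "0 < \<alpha> * \<rho>" using \<alpha> \<rho> by auto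
  have \<theta>: "0 < \<theta>" "\<theta> \<le> pi" "\<alpha> * \<theta> \<le> pi"
  proof -
    show "0 < \<theta>" "\<theta> \<le> pi" using \<alpha> by (auto simp: \<theta>_def mult_le_cancel_left2)
    have "\<theta> \<le> pi * (1 / \<alpha>)" unfolding \<theta>_def by (intro mult_left_mono) auto
    then show "\<alpha> * \<theta> \<le> pi" using \<alpha> by (simp add: field_simps)
  qed
  then show "0 < pi * min 1 (1 / \<alpha>)" "pi * min 1 (1 / \<alpha>) \<le> pi" by (simp_all add: \<theta>_def)
  have sub: "sector \<theta> \<subseteq> sector pi" using \<theta> by (intro sector_mono)
  show "(\<lambda>z. phi z \<alpha> \<rho>) meromorphic_on sector (pi * min 1 (1 / \<alpha>))"
    using meromorphic_on_subset[OF phi_meromorphic[OF \<alpha> \<rho>] sub] by (simp add: \<theta>_def)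
  have "(\<lambda>z. z powr of_real \<alpha>) ` sector \<theta> \<subseteq> sector pi"
    unfolding sector_eq_exp_image[OF order_refl] sector_eq_exp_image[OF \<theta>(2)]
  proof clarify
    fix t assume t: "t \<in> strip \<theta>"
    then have "\<bar>Im t\<bar> < pi" using \<theta> by (simp add: strip_def)
    then have "exp t powr of_real \<alpha> = exp (of_real \<alpha> * t)" by (simp add: powr_def)
    moreover have "of_real \<alpha> * t \<in> strip pi"
    proof -
      have "\<alpha> * \<bar>Im t\<bar> < \<alpha> * \<theta>" using t \<alpha> by (simp add: strip_def)
      then have "\<alpha> * \<bar>Im t\<bar> < pi" using \<theta>(3) by (rule less_le_trans)
      then show ?thesis using \<alpha> by (simp add: strip_def abs_mult)
    qed
    ultimately show "exp t powr of_real \<alpha> \<in> exp ` strip pi" by blast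
  qed
  moreover have "(\<lambda>z. z powr of_real \<alpha>) analytic_on sector \<theta>"
    using sub by (intro analytic_intros) (auto simp: sector_pi_iff[symmetric])
  ultimately show "(\<lambda>z. phi (z powr of_real \<alpha>) (1 / \<alpha>) (\<alpha> * \<rho>)) meromorphic_on sector (pi * min 1 (1 / \<alpha>))"
    using meromorphic_on_compose[OF phi_meromorphic[OF p' \<alpha>\<rho>]] by (simp add: \<theta>_def)
  fix s :: real
  have "exp (complex_of_real s) powr of_real \<alpha> = exp (of_real (\<alpha> * s))" by (simp add: powr_def)
  then show "phi (exp (of_real s)) \<alpha> \<rho> = phi (exp (of_real s) powr of_real \<alpha>) (1 / \<alpha>) (\<alpha> * \<rho>)"
    using log_phi_duality[OF assms, of "of_real s"] phi_width_gt[OF \<alpha> \<rho>]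
    by (simp only: phi_exp_of_real[OF \<alpha> \<rho>] phi_exp_of_real[OF p' \<alpha>\<rho>]) simp
qed

lemma phi_multiplication:
  assumes \<rho>: "0 < \<rho>" "\<rho> < 1" and n: "n \<ge> 2" and \<alpha>n: "\<alpha> > real n - 1"
  shows "mero_eq (sector (pi * (1 - (real n - 1) / \<alpha>)))
          (\<lambda>z. phi z \<alpha> \<rho>)
          (\<lambda>z. \<Prod>k = 0..n - 1.
             phi (z * exp (of_real (real n - 2 * real k - 1) * of_real pi * \<i> / of_real \<alpha>))
                 (\<alpha> / real n) \<rho>)"
proof (rule mero_eq_sectorI)
  have \<alpha>: "\<alpha> > 0" using n \<alpha>n by linarith
  have an: "\<alpha> / real n > 0" using \<alpha> n by simp
  define b where "b = (real n - 1) * (pi / \<alpha>)"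
  define y where "y k = (real n - 2 * real k - 1) / \<alpha> * pi" for k
  have yb: "\<bar>y k\<bar> \<le> b" if k: "k \<in> {0..n-1}" for k
  proof -
    have "\<bar>real n - 2 * real k - 1\<bar> \<le> real n - 1" using k n by (intro abs_centred_index_le) auto
    then have "\<bar>real n - 2 * real k - 1\<bar> * (pi / \<alpha>) \<le> (real n - 1) * (pi / \<alpha>)" using \<alpha> by (intro mult_right_mono) auto
    then show ?thesis using \<alpha> by (simp add: abs_mult y_def b_def)
  qed
  have b: "0 < b" "b < pi"
  proof -
    show "0 < b" using n \<alpha> by (simp add: b_def)
    have "b < \<alpha> * (pi / \<alpha>)" unfolding b_def using \<alpha> \<alpha>n by (intro mult_strict_right_mono) auto
    then show "b < pi" using \<alpha> by simp
  qed
  have \<theta>: "pi * (1 - (real n - 1) / \<alpha>) = pi - b" by (simp add: b_def field_simps)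
  have e: "exp (of_real (real n - 2 * real k - 1) * of_real pi * \<i> / of_real \<alpha>) = exp (\<i> * of_real (y k))" for k
    by (simp add: y_def mult_ac)
  show "0 < pi * (1 - (real n - 1) / \<alpha>)" "pi * (1 - (real n - 1) / \<alpha>) \<le> pi" unfolding \<theta> using b by auto
  have b': "pi - b \<le> pi" using b by simp
  have sub: "sector (pi - b) \<subseteq> sector pi" using b' by (rule sector_mono)
  show "(\<lambda>z. phi z \<alpha> \<rho>) meromorphic_on sector (pi * (1 - (real n - 1) / \<alpha>))"
    unfolding \<theta> by (rule meromorphic_on_subset[OF phi_meromorphic[OF \<alpha> \<rho>] sub])
  show "(\<lambda>z. \<Prod>k = 0..n - 1. phi (z * exp (of_real (real n - 2 * real k - 1) * of_real pi * \<i> / of_real \<alpha>)) (\<alpha> / real n) \<rho>)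
      meromorphic_on sector (pi * (1 - (real n - 1) / \<alpha>))"
    unfolding \<theta> e
  proof (rule meromorphic_on_prod)
    fix k assume k: "k \<in> {0..n-1}"
    have "(\<lambda>z. z * exp (\<i> * of_real (y k))) ` sector (pi - b) \<subseteq> sector pi"
      unfolding sector_eq_exp_image[OF order_refl] sector_eq_exp_image[OF b']
    proof clarify
      fix t assume t: "t \<in> strip (pi - b)"
      have "t + \<i> * of_real (y k) \<in> strip pi"
        using t yb[OF k] abs_triangle_ineq[of "Im t" "y k"] by (simp add: strip_def)
      then show "exp t * exp (\<i> * of_real (y k)) \<in> exp ` strip pi" by (metis exp_add image_eqI)
    qed
    then show "(\<lambda>z. phi (z * exp (\<i> * of_real (y k))) (\<alpha> / real n) \<rho>) meromorphic_on sector (pi - b)"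
      by (intro meromorphic_on_compose[OF phi_meromorphic[OF an \<rho>]] analytic_intros)
  qed
  fix s :: real
  have W: "b < phi_width (\<alpha> / real n) \<rho>"
  proof -
    have "phi_width (\<alpha> / real n) \<rho> = phi_width \<alpha> \<rho> + b"
      using \<alpha> by (simp add: phi_width_def b_def field_simps)
    then show ?thesis using phi_width_gt[OF \<alpha> \<rho>] by simp
  qed
  have "phi (exp (of_real s)) \<alpha> \<rho> = exp (\<Sum>k = 0..n - 1. log_phi (\<alpha> / real n) \<rho> (of_real s + \<i> * of_real (y k)))"
    unfolding phi_exp_of_real[OF \<alpha> \<rho>] y_def
    using log_phi_multiplication[OF \<alpha> \<rho>, of n "of_real s"] n phi_width_gt[OF \<alpha> \<rho>] by simp
  also have "\<dots> = (\<Prod>k = 0..n - 1. phi (exp (of_real s) * exp (\<i> * of_real (y k))) (\<alpha> / real n) \<rho>)"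
    unfolding exp_sum[OF finite_atLeastAtMost]
  proof (rule prod.cong)
    fix k assume k: "k \<in> {0..n-1}"
    have "phi (exp (of_real s + \<i> * of_real (y k))) (\<alpha> / real n) \<rho> = exp (log_phi (\<alpha> / real n) \<rho> (of_real s + \<i> * of_real (y k)))"
      using yb[OF k] b W by (intro phi_exp an \<rho>) auto
    then show "exp (log_phi (\<alpha> / real n) \<rho> (of_real s + \<i> * of_real (y k))) = phi (exp (of_real s) * exp (\<i> * of_real (y k))) (\<alpha> / real n) \<rho>"
      by (simp add: exp_add)
  qed simp
  finally show "phi (exp (of_real s)) \<alpha> \<rho> = (\<Prod>k = 0..n - 1. phi (exp (of_real s) * exp (of_real (real n - 2 * real k - 1) * of_real pi * \<i> / of_real \<alpha>)) (\<alpha> / real n) \<rho>)"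
    unfolding e .
qed

text \<open>
  The ray \<open>arg z = \<delta> \<pi> \<rho>\<close> is chosen because there both \<open>z\<close> (for the parameter \<open>1 - \<rho>\<close>) and \<open>- z\<close> (for
  \<open>\<rho>\<close>, with argument of size \<open>\<pi> (1 - \<rho>)\<close>) lie in the sectors covered by \<open>log_phi\<close>.
\<close>
lemma phi_complement_half_plane:
  assumes \<alpha>: "\<alpha> > 0" and \<rho>: "0 < \<rho>" "\<rho> < 1" and \<delta>: "\<delta> \<in> {1, -1::real}"
  shows "mero_eq {z. \<delta> * Im z > 0} (\<lambda>z. phi z \<alpha> (1 - \<rho>) * phi (- z) \<alpha> \<rho>)
          (\<lambda>z. inverse (1 + exp (- of_real (sgn (Im z)) * of_real pi * \<i> * of_real (\<alpha> * \<rho>))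
                             * z powr of_real \<alpha>))"
proof -
  define S where "S = {z. \<delta> * Im z > 0}"
  define y where "y = \<delta> * (pi * \<rho>)"
  have \<rho>': "0 < 1 - \<rho>" "1 - \<rho> < 1" using \<rho> by auto
  have \<pi>\<rho>: "0 < pi * \<rho>" "pi * \<rho> < pi" using \<rho> by auto
  have S: "open S" unfolding S_def by (intro open_Collect_less continuous_intros)
  have "S = (if \<delta> = 1 then {z. Im z > 0} else {z. Im z < 0})" using \<delta> by (auto simp: S_def)
  then have conn: "connected S" by (auto intro!: convex_connected convex_halfspace_Im_gt convex_halfspace_Im_lt)
  have ns: "z \<notin> \<real>\<^sub>\<le>\<^sub>0" "- z \<notin> \<real>\<^sub>\<le>\<^sub>0" "sgn (Im z) = \<delta>" if "z \<in> S" for z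
    using that \<delta> by (auto simp: S_def complex_nonpos_Reals_iff sgn_real_def)
  have yS: "exp (of_real s + \<i> * of_real y) \<in> S" for s
  proof -
    have "sin (pi * \<rho>) > 0" using \<pi>\<rho> by (intro sin_gt_zero) auto
    then show ?thesis using \<delta> by (auto simp: S_def y_def Im_exp)
  qed
  have "mero_eq S (\<lambda>z. phi z \<alpha> (1 - \<rho>) * phi (- z) \<alpha> \<rho>)
          (\<lambda>z. inverse (1 + exp (- of_real (sgn (Im z)) * of_real pi * \<i> * of_real (\<alpha> * \<rho>)) * z powr of_real \<alpha>))"
  proof (rule mero_eq_if_eq_on_ray[where y = y, OF S conn])
    show "exp (\<i> * of_real y) \<in> S" using yS[of 0] by simp
    show "(\<lambda>z. phi z \<alpha> (1 - \<rho>) * phi (- z) \<alpha> \<rho>) meromorphic_on S"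
    proof (rule meromorphic_on_mult)
      show "(\<lambda>z. phi z \<alpha> (1 - \<rho>)) meromorphic_on S"
        by (rule meromorphic_on_subset[OF phi_meromorphic[OF \<alpha> \<rho>']]) (auto simp: sector_pi_iff ns)
      show "(\<lambda>z. phi (- z) \<alpha> \<rho>) meromorphic_on S"
        by (intro meromorphic_on_compose[OF phi_meromorphic[OF \<alpha> \<rho>]] analytic_intros) (use ns(2) in \<open>auto simp only: sector_pi_iff\<close>)
    qed
    have mer: "(\<lambda>z. inverse (1 + exp (- of_real \<delta> * of_real pi * \<i> * of_real (\<alpha> * \<rho>)) * z powr of_real \<alpha>)) meromorphic_on S"
      by (intro meromorphic_on_inverse analytic_on_imp_meromorphic_on analytic_intros) (auto simp: ns)
    have ev: "\<forall>\<^sub>F z in at z0. inverse (1 + exp (- of_real (sgn (Im z)) * of_real pi * \<i> * of_real (\<alpha> * \<rho>)) * z powr of_real \<alpha>) =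
        inverse (1 + exp (- of_real \<delta> * of_real pi * \<i> * of_real (\<alpha> * \<rho>)) * z powr of_real \<alpha>)" if "z0 \<in> S" for z0
      using eventually_at_in_open'[OF S that] by eventually_elim (simp add: ns)
    show "(\<lambda>z. inverse (1 + exp (- of_real (sgn (Im z)) * of_real pi * \<i> * of_real (\<alpha> * \<rho>)) * z powr of_real \<alpha>)) meromorphic_on S"
      by (rule iffD2[OF meromorphic_on_cong[OF ev refl] mer])
    fix s :: real
    define t where "t = of_real s + \<i> * of_real (y - \<delta> * pi)"
    have t1: "t + \<i> * of_real (\<delta> * pi) = of_real s + \<i> * of_real y" by (simp add: t_def algebra_simps)
    have "\<bar>Im t\<bar> = pi - pi * \<rho>" using \<delta> \<pi>\<rho> by (auto simp: t_def y_def)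
    then have Imt: "\<bar>Im t\<bar> < pi" "\<bar>Im t\<bar> < phi_width \<alpha> \<rho>" using \<pi>\<rho> \<alpha> by (auto simp: phi_width_def algebra_simps)
    have ay: "\<bar>y\<bar> = pi * \<rho>" using \<delta> \<pi>\<rho> by (auto simp: y_def)
    then have Imy: "\<bar>y\<bar> < pi" "\<bar>y\<bar> < phi_width \<alpha> (1 - \<rho>)" using \<pi>\<rho> \<alpha> by (auto simp: phi_width_def)
    have phi1: "phi (exp (of_real s + \<i> * of_real y)) \<alpha> (1 - \<rho>) = exp (log_phi \<alpha> (1 - \<rho>) (t + \<i> * of_real (\<delta> * pi)))"
      unfolding t1 using Imy by (intro phi_exp \<alpha> \<rho>') auto
    have "exp (\<i> * of_real (\<delta> * pi)) = -1" using \<delta> by (auto simp: exp_minus)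
    then have m: "- exp (of_real s + \<i> * of_real y) = exp t"
      unfolding t1[symmetric] exp_add by simp
    have phi2: "phi (- exp (of_real s + \<i> * of_real y)) \<alpha> \<rho> = exp (log_phi \<alpha> \<rho> t)"
      unfolding m by (intro phi_exp \<alpha> \<rho> Imt)
    have pw: "exp (of_real s + \<i> * of_real y) powr of_real \<alpha> = exp (of_real \<alpha> * (t + \<i> * of_real (\<delta> * pi)))"
      unfolding t1 using Imy by (simp add: powr_def)
    have X: "exp (- of_real \<delta> * of_real pi * \<i> * of_real (\<alpha> * \<rho>)) * exp (of_real s + \<i> * of_real y) powr of_real \<alpha> =
       exp (of_real \<alpha> * (t + \<i> * of_real (\<delta> * pi)) - \<i> * of_real (\<delta> * pi * \<alpha> * \<rho>))"
      unfolding pw exp_add[symmetric] by (rule arg_cong[of _ _ exp]) (simp add: algebra_simps)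
    have "Im t + \<delta> * pi = y" by (simp add: t_def)
    then have "exp (log_phi \<alpha> (1 - \<rho>) (t + \<i> * of_real (\<delta> * pi))) * exp (log_phi \<alpha> \<rho> t) *
       (1 + exp (of_real \<alpha> * (t + \<i> * of_real (\<delta> * pi)) - \<i> * of_real (\<delta> * pi * \<alpha> * \<rho>))) = 1"
      using Imy by (intro log_phi_complement_signed[OF \<alpha> \<rho> \<delta> Imt(2)]) simp
    then show "phi (exp (of_real s + \<i> * of_real y)) \<alpha> (1 - \<rho>) * phi (- exp (of_real s + \<i> * of_real y)) \<alpha> \<rho> =
      inverse (1 + exp (- of_real (sgn (Im (exp (of_real s + \<i> * of_real y)))) * of_real pi * \<i> * of_real (\<alpha> * \<rho>)) * exp (of_real s + \<i> * of_real y) powr of_real \<alpha>)"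
      unfolding ns(3)[OF yS] X phi1 phi2 by (intro inverse_unique[symmetric]) (simp only: mult.commute)
  qed
  then show ?thesis by (simp only: S_def)
qed

lemma phi_complement:
  assumes \<alpha>: "\<alpha> > 0" and \<rho>: "0 < \<rho>" "\<rho> < 1"
  shows "mero_eq {z. Im z \<noteq> 0} (\<lambda>z. phi z \<alpha> (1 - \<rho>) * phi (- z) \<alpha> \<rho>)
          (\<lambda>z. inverse (1 + exp (- of_real (sgn (Im z)) * of_real pi * \<i> * of_real (\<alpha> * \<rho>))
                             * z powr of_real \<alpha>))"
proof -
  have "{z. Im z \<noteq> 0} = {z. 1 * Im z > 0} \<union> {z. - 1 * Im z > 0}" by auto
  moreover have op: "open {z. c * Im z > 0}" for c :: real by (intro open_Collect_less continuous_intros)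
  ultimately show ?thesis
    using mero_eq_Un[OF op op phi_complement_half_plane[OF assms, of 1] phi_complement_half_plane[OF assms, of "-1"]]
    by simp
qed

theorem theorem6:
  fixes \<rho> :: real
  assumes "0 < \<rho>" and "\<rho> < 1"
  shows
    "(\<forall>\<alpha>::real. \<alpha> > 0 \<longrightarrow>
        mero_eq (sector pi)
          (\<lambda>z. phi (1 / z) \<alpha> \<rho>)
          (\<lambda>z. z powr of_real (\<alpha> * \<rho>) * phi z \<alpha> \<rho>)) \<and>
     (\<forall>\<alpha>::real. 0 < \<alpha> \<and> \<alpha> < 1 / \<rho> \<longrightarrow>
        mero_eq (sector (pi * min 1 (1 / \<alpha>)))
          (\<lambda>z. phi z \<alpha> \<rho>)
          (\<lambda>z. phi (z powr of_real \<alpha>) (1 / \<alpha>) (\<alpha> * \<rho>))) \<and>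
     (\<forall>(n::nat) (\<alpha>::real). n \<ge> 2 \<and> \<alpha> > real n - 1 \<longrightarrow>
        mero_eq (sector (pi * (1 - (real n - 1) / \<alpha>)))
          (\<lambda>z. phi z \<alpha> \<rho>)
          (\<lambda>z. \<Prod>k = 0..n - 1.
             phi (z * exp (of_real (real n - 2 * real k - 1) * of_real pi * \<i> / of_real \<alpha>))
                 (\<alpha> / real n) \<rho>)) \<and>
     (\<forall>\<alpha>::real. \<alpha> > 0 \<longrightarrow>
        mero_eq {z. Im z \<noteq> 0}
          (\<lambda>z. phi z \<alpha> (1 - \<rho>) * phi (- z) \<alpha> \<rho>)
          (\<lambda>z. inverse (1 + exp (- of_real (sgn (Im z)) * of_real pi * \<i> * of_real (\<alpha> * \<rho>))
                             * z powr of_real \<alpha>)))"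
proof -
  have lt: "\<alpha> * \<rho> < 1" if "\<alpha> < 1 / \<rho>" for \<alpha> using that assms by (simp add: field_simps)
  show ?thesis
    by (intro conjI allI impI; (elim conjE)?;
        intro phi_inversion phi_duality phi_multiplication phi_complement assms lt; assumption)
qed

end
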